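(* Let $d\ge1$ be an integer, $a\in\mathbb F\setminus\{0,1\}$, $V=V_d(a)$. For each $i\in\mathbb I$ fix a nonzero vector $\eta_i$ in component $0$ of the flag $[i]$ for $V$, and let $\langle\,,\rangle$ be a standard bilinear form on $V$. Let $i,j,k,\ell\in\mathbb I$ be mutually distinct, let $\alpha$ be the $(i,j,k,\ell)$-relative of $a$, and consider the transition matrices from the basis $[i,j,k,\ell]$ of $V$ to the bases $[j,i,k,\ell]$, $[i,k,j,\ell]$, $[i,j,\ell,k]$ of $V$. (i) The first transition matrix is diagonal with $(r,r)$-entry $$\frac{\langle\eta_j,\eta_\ell\rangle}{\langle\eta_i,\eta_\ell\rangle}\,\alpha^r\qquad(0\le r\le d).$$ (ii) The second transition matrix is lower triangular with $(r,s)$-entry $$\binom{r}{s}\alpha^{r-s}(1-\alpha)^s\qquad(0\le s\le r\le d).$$ (iii) The third transition matrix is the matrix $Z$ with $(r,s)$-entry $1$ if $r+s=d$ and $0$ if $r+s\ne d$ $(0\le r,s\le d)$.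
   Context: $\mathbb F$ is an algebraically closed field of characteristic $0$, and $\mathbb I=\{0,1,2,3\}$. The tetrahedron algebra $\boxtimes$ is the Lie algebra over $\mathbb F$ with generators $\{x_{ij}\mid i,j\in\mathbb I,\ i\ne j\}$ and relations: (i) $x_{ij}+x_{ji}=0$ for distinct $i,j$; (ii) $[x_{ij},x_{jk}]=2x_{ij}+2x_{jk}$ for mutually distinct $i,j,k$; (iii) $[x_{ij},[x_{ij},[x_{ij},x_{k\ell}]]]=4[x_{ij},x_{k\ell}]$ for mutually distinct $i,j,k,\ell$. Evaluation modules: let $\mathfrak{sl}_2=\mathfrak{sl}_2(\mathbb F)$ with basis $e,f,h$, $[h,e]=2e$, $[h,f]=-2f$, $[e,f]=h$. Put $x=2e-h$, $y=-2f-h$, $z=h$. For $a\in\mathbb F\setminus\{0,1\}$ let $EV_a:\boxtimes\to\mathfrak{sl}_2$ be the (surjective) Lie algebra homomorphism with $x_{12}\mapsto x$, $x_{23}\mapsto y$, $x_{31}\mapsto z$, $x_{03}\mapsto ay+(a-1)z$, $x_{01}\mapsto(1-a^{-1})z-a^{-1}x$, $x_{02}\mapsto(1-a)^{-1}x+a(1-a)^{-1}y$. For $d\ge0$ let $V_d$ be the irreducible $\mathfrak{sl}_2$-module of dimension $d+1$. For $d\ge1$, $V_d(a)$ is the (irreducible) $\boxtimes$-module obtained from $V_d$ by pulling back the action via $EV_a$. On $V_d(a)$ each $x_{ij}$ is diagonalizable with eigenvalues $2n-d$ ($0\le n\le d$), each eigenspace having dimension $1$. Decompositions and flags of $V=V_d(a)$: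 for distinct $k,\ell\in\mathbb I$, component $n$ ($0\le n\le d$) of the decomposition $[k,\ell]$ is the eigenspace of $x_{k\ell}$ for eigenvalue $2n-d$. For $i\in\mathbb I$, component $n$ of the flag $[i]$ is the sum of components $0,1,\dots,n$ of the decomposition $[i,j]$, for any $j\ne i$ (this is known to be independent of $j$); in particular component $0$ of $[i]$ is the eigenspace of $x_{ij}$ with eigenvalue $-d$. A standard bilinear form on $V$ is a nonzero bilinear form with $\langle\xi.u,v\rangle=-\langle u,\xi.v\rangle$ for all $\xi\in\boxtimes$, $u,v\in V$; it exists, is unique up to nonzero scalar and is nondegenerate, and $\langle\eta_i,\eta_j\rangle\ne0$ for distinct $i,j$. Given the fixed vectors $\eta_i$, for mutually distinct $i,j,k,\ell$ the basis $[i,j,k,\ell]$ of $V$ is the unique basis $\{u_n\}_{n=0}^d$ such that $u_n$ is in component $n$ of the decomposition $[k,\ell]$ for $0\le n\le d$, and $\eta_i=\sum_{n=0}^d u_n$. The transition matrix from a basis $\{u_n\}_{n=0}^d$ to a basis $\{v_n\}_{n=0}^d$ is the matrix $T$ with $v_q=\sum_{p=0}^d T_{pq}u_p$ for $0\le q\le d$. Relatives: $S_4$, the group of permutations of $\mathbb I$ (products composed right to left), acts on $\mathbb F\setminus\{0,1\}$ by the unique action in which the transpositions $(2,0)$, $(0,1)$, $(1,3)$ send $a\mapsto a^{-1}$, $a\mapsto a(a-1)^{-1}$, $a\mapsto a^{-1}$ respectively. The $(i,j,k,\ell)$-relative of $a$ is $\sigma(a)$, where $\sigma\in S_4$ satisfies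 $\sigma(i)=2$, $\sigma(j)=0$, $\sigma(k)=1$, $\sigma(\ell)=3$. *)

theory Defs
  imports
    "HOL-Analysis.Determinants"
    "HOL-Computational_Algebra.Polynomial"
    "HOL-Algebra.Group_Action"
begin

section \<open>Lie algebras and their modules\<close>

locale lie_algebra = vector_space scale
  for scale :: "'f::field \<Rightarrow> 'g::ab_group_add \<Rightarrow> 'g" +
  fixes br :: "'g \<Rightarrow> 'g \<Rightarrow> 'g"
  assumes br_linear_right: "Vector_Spaces.linear scale scale (\<lambda>y. br x y)"
    and br_linear_left: "Vector_Spaces.linear scale scale (\<lambda>x. br x y)"
    and br_self: "br x x = 0"
    and jacobi: "br x (br y z) + br y (br z x) + br z (br x y) = 0"

definition lie_hom ::
  "('f::field \<Rightarrow> 'g::ab_group_add \<Rightarrow> 'g) \<Rightarrow> ('g \<Rightarrow> 'g \<Rightarrow> 'g) \<Rightarrow>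
   ('f \<Rightarrow> 'h::ab_group_add \<Rightarrow> 'h) \<Rightarrow> ('h \<Rightarrow> 'h \<Rightarrow> 'h) \<Rightarrow> ('g \<Rightarrow> 'h) \<Rightarrow> bool" where
  "lie_hom s1 b1 s2 b2 f \<longleftrightarrow>
     Vector_Spaces.linear s1 s2 f \<and> (\<forall>x y. f (b1 x y) = b2 (f x) (f y))"

locale lie_module = lie_algebra scale br + V: vector_space scaleV
  for scale :: "'f::field \<Rightarrow> 'g::ab_group_add \<Rightarrow> 'g" and br
    and scaleV :: "'f \<Rightarrow> 'v::ab_group_add \<Rightarrow> 'v" +
  fixes act :: "'g \<Rightarrow> 'v \<Rightarrow> 'v"
  assumes act_linear_right: "Vector_Spaces.linear scaleV scaleV (\<lambda>v. act x v)"
    and act_linear_left: "Vector_Spaces.linear scale scaleV (\<lambda>x. act x v)"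
    and act_br: "act (br x y) v = act x (act y v) - act y (act x v)"

locale irreducible_lie_module = lie_module scale br scaleV act
  for scale :: "'f::field \<Rightarrow> 'g::ab_group_add \<Rightarrow> 'g" and br
    and scaleV :: "'f \<Rightarrow> 'v::ab_group_add \<Rightarrow> 'v" and act +
  assumes nonzero: "(UNIV :: 'v set) \<noteq> {0}"
    and irreducible: "\<lbrakk>V.subspace W; \<And>x w. w \<in> W \<Longrightarrow> act x w \<in> W\<rbrakk> \<Longrightarrow> W = {0} \<or> W = UNIV"


section \<open>The tetrahedron algebra\<close>

datatype idx = I0 | I1 | I2 | I3

text \<open>The Lie algebra given by generators and relations is built as formal Lie expressions in
  the generators modulo the least congruence containing the Lie algebra axioms and the defining
  relations. Expressions \<open>Gen i i\<close> are junk and are identified with 0.\<close>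

datatype 'f lie_expr =
    Gen idx idx
  | Zero
  | Add "'f lie_expr" "'f lie_expr"
  | Scale 'f "'f lie_expr"
  | Br "'f lie_expr" "'f lie_expr"

inductive tet_eq :: "'f::field lie_expr \<Rightarrow> 'f lie_expr \<Rightarrow> bool" where
  tet_refl: "tet_eq s s"
| tet_sym: "tet_eq s t \<Longrightarrow> tet_eq t s"
| tet_trans: "tet_eq s t \<Longrightarrow> tet_eq t u \<Longrightarrow> tet_eq s u"
| Add_cong: "tet_eq s s' \<Longrightarrow> tet_eq t t' \<Longrightarrow> tet_eq (Add s t) (Add s' t')"
| Scale_cong: "tet_eq s s' \<Longrightarrow> tet_eq (Scale c s) (Scale c s')"
| Br_cong: "tet_eq s s' \<Longrightarrow> tet_eq t t' \<Longrightarrow> tet_eq (Br s t) (Br s' t')"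
| Add_assoc: "tet_eq (Add (Add s t) u) (Add s (Add t u))"
| Add_comm: "tet_eq (Add s t) (Add t s)"
| Add_Zero: "tet_eq (Add Zero s) s"
| Add_inverse: "tet_eq (Add (Scale (-1) s) s) Zero"
| Scale_Add_right: "tet_eq (Scale c (Add s t)) (Add (Scale c s) (Scale c t))"
| Scale_Add_left: "tet_eq (Scale (c + c') s) (Add (Scale c s) (Scale c' s))"
| Scale_Scale: "tet_eq (Scale c (Scale c' s)) (Scale (c * c') s)"
| Scale_one: "tet_eq (Scale 1 s) s"
| Br_Add_left: "tet_eq (Br (Add s t) u) (Add (Br s u) (Br t u))"
| Br_Add_right: "tet_eq (Br s (Add t u)) (Add (Br s t) (Br s u))"
| Br_Scale_left: "tet_eq (Br (Scale c s) t) (Scale c (Br s t))"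
| Br_Scale_right: "tet_eq (Br s (Scale c t)) (Scale c (Br s t))"
| Br_self: "tet_eq (Br s s) Zero"
| Jacobi: "tet_eq (Add (Add (Br s (Br t u)) (Br t (Br u s))) (Br u (Br s t))) Zero"
| Gen_junk: "tet_eq (Gen i i) Zero"
| Rel_i: "i \<noteq> j \<Longrightarrow> tet_eq (Add (Gen i j) (Gen j i)) Zero"
| Rel_ii: "distinct [i, j, k] \<Longrightarrow>
    tet_eq (Br (Gen i j) (Gen j k)) (Add (Scale 2 (Gen i j)) (Scale 2 (Gen j k)))"
| Rel_iii: "distinct [i, j, k, l] \<Longrightarrow>
    tet_eq (Br (Gen i j) (Br (Gen i j) (Br (Gen i j) (Gen k l))))
           (Scale 4 (Br (Gen i j) (Gen k l)))"

quotient_type (overloaded) 'f tet = "'f::field lie_expr" / tet_eq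
proof (rule equivpI)
  show "reflp tet_eq" by (simp add: reflp_def tet_eq.tet_refl)
  show "symp tet_eq" by (auto simp: symp_def intro: tet_eq.tet_sym)
  show "transp tet_eq" by (auto simp: transp_def intro: tet_eq.tet_trans)
qed

instantiation tet :: (field) ab_group_add
begin

lift_definition zero_tet :: "'a tet" is Zero .
lift_definition plus_tet :: "'a tet \<Rightarrow> 'a tet \<Rightarrow> 'a tet" is Add by (rule tet_eq.Add_cong)
lift_definition uminus_tet :: "'a tet \<Rightarrow> 'a tet" is "Scale (-1)" by (rule tet_eq.Scale_cong)
definition minus_tet :: "'a tet \<Rightarrow> 'a tet \<Rightarrow> 'a tet" where "minus_tet x y = x + - y"

instance
proof
  fix a b c :: "'a tet"
  show "a + b + c = a + (b + c)" by transfer (rule tet_eq.Add_assoc)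
  show "a + b = b + a" by transfer (rule tet_eq.Add_comm)
  show "0 + a = a" by transfer (rule tet_eq.Add_Zero)
  show "- a + a = 0" by transfer (rule tet_eq.Add_inverse)
  show "a - b = a + - b" by (rule minus_tet_def)
qed

end

lift_definition tet_scale :: "'f::field \<Rightarrow> 'f tet \<Rightarrow> 'f tet" is Scale by (rule tet_eq.Scale_cong)
lift_definition tet_br :: "'f::field tet \<Rightarrow> 'f tet \<Rightarrow> 'f tet" is Br by (rule tet_eq.Br_cong)
lift_definition tet_x :: "idx \<Rightarrow> idx \<Rightarrow> 'f::field tet" is Gen .

lemma vector_space_tet: "vector_space (tet_scale :: 'f::field \<Rightarrow> _)"
proof
  fix c c' :: 'f and x y
  show "tet_scale c (x + y) = tet_scale c x + tet_scale c y"
    by transfer (rule tet_eq.Scale_Add_right)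
  show "tet_scale (c + c') x = tet_scale c x + tet_scale c' x"
    by transfer (rule tet_eq.Scale_Add_left)
  show "tet_scale c (tet_scale c' x) = tet_scale (c * c') x"
    by transfer (rule tet_eq.Scale_Scale)
  show "tet_scale 1 x = x" by transfer (rule tet_eq.Scale_one)
qed

interpretation tet: lie_algebra "tet_scale :: 'f::field \<Rightarrow> _" tet_br
proof (intro lie_algebra.intro lie_algebra_axioms.intro vector_space_tet)
  fix x y z :: "'f tet"
  show "Vector_Spaces.linear tet_scale tet_scale (\<lambda>y. tet_br x y)"
    unfolding Vector_Spaces.linear_iff
    by (intro conjI allI vector_space_tet; transfer) (rule tet_eq.Br_Add_right tet_eq.Br_Scale_right)+
  show "Vector_Spaces.linear tet_scale tet_scale (\<lambda>x. tet_br x y)"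
    unfolding Vector_Spaces.linear_iff
    by (intro conjI allI vector_space_tet; transfer) (rule tet_eq.Br_Add_left tet_eq.Br_Scale_left)+
  show "tet_br x x = 0" by transfer (rule tet_eq.Br_self)
  show "tet_br x (tet_br y z) + tet_br y (tet_br z x) + tet_br z (tet_br x y) = 0"
    by transfer (rule tet_eq.Jacobi)
qed

text \<open>The universal property of the presentation.\<close>

primrec lie_eval ::
  "('f \<Rightarrow> 'g::ab_group_add \<Rightarrow> 'g) \<Rightarrow> ('g \<Rightarrow> 'g \<Rightarrow> 'g) \<Rightarrow> (idx \<Rightarrow> idx \<Rightarrow> 'g) \<Rightarrow> 'f lie_expr \<Rightarrow> 'g" where
  "lie_eval sc br g (Gen i j) = g i j"
| "lie_eval sc br g Zero = 0"
| "lie_eval sc br g (Add s t) = lie_eval sc br g s + lie_eval sc br g t"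
| "lie_eval sc br g (Scale c s) = sc c (lie_eval sc br g s)"
| "lie_eval sc br g (Br s t) = br (lie_eval sc br g s) (lie_eval sc br g t)"

context lie_algebra
begin

lemma br_add_right: "br x (y + z) = br x y + br x z"
  and br_scale_right: "br x (scale c y) = scale c (br x y)"
  using br_linear_right[of x] unfolding Vector_Spaces.linear_iff by blast+

lemma br_add_left: "br (x + y) z = br x z + br y z"
  and br_scale_left: "br (scale c x) z = scale c (br x z)"
  using br_linear_left[of z] unfolding Vector_Spaces.linear_iff by blast+

lemma tet_universal:
  assumes g0: "\<And>i. g i i = 0"
    and g1: "\<And>i j. i \<noteq> j \<Longrightarrow> g i j + g j i = 0"
    and g2: "\<And>i j k. distinct [i, j, k] \<Longrightarrow> br (g i j) (g j k) = scale 2 (g i j) + scale 2 (g j k)"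
    and g3: "\<And>i j k l. distinct [i, j, k, l] \<Longrightarrow>
      br (g i j) (br (g i j) (br (g i j) (g k l))) = scale 4 (br (g i j) (g k l))"
  shows "\<exists>\<phi>. lie_hom tet_scale tet_br scale br \<phi> \<and> (\<forall>i j. \<phi> (tet_x i j) = g i j)"
proof -
  let ?ev = "lie_eval scale br g"
  have resp: "?ev s = ?ev t" if "tet_eq s t" for s t
    using that
  proof induction
    case (Rel_ii i j k)
    then show ?case using g2[of i j k] by simp
  next
    case (Rel_iii i j k l)
    then show ?case using g3[of i j k l] by simp
  next
    case (Jacobi s t u)
    then show ?case by (simp add: jacobi)
  qed (simp_all add: algebra_simps br_add_right br_add_left br_scale_right br_scale_left br_self
        g0 g1)
  define \<phi> where "\<phi> X = ?ev (rep_tet X)" for X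
  have ab: "\<phi> (abs_tet s) = ?ev s" for s
    unfolding \<phi>_def by (rule resp) (meson Quotient3_tet rep_abs_rsp_left tet_eq.tet_refl)
  have ex: "\<exists>s. X = abs_tet s" for X :: "'f tet"
    by (metis Quotient3_abs_rep Quotient3_tet)
  have "lie_hom tet_scale tet_br scale br \<phi>"
    unfolding lie_hom_def Vector_Spaces.linear_iff
  proof (intro conjI allI vector_space_tet)
    show "vector_space scale" by unfold_locales
    fix X Y :: "'f tet" and c
    obtain s t where st: "X = abs_tet s" "Y = abs_tet t" using ex by meson
    show "\<phi> (X + Y) = \<phi> X + \<phi> Y" by (simp add: st plus_tet.abs_eq ab)
    show "\<phi> (tet_scale c X) = scale c (\<phi> X)" by (simp add: st tet_scale.abs_eq ab)
    show "\<phi> (tet_br X Y) = br (\<phi> X) (\<phi> Y)" by (simp add: st tet_br.abs_eq ab)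
  qed
  moreover have "\<phi> (tet_x i j) = g i j" for i j by (simp add: tet_x_def ab)
  ultimately show ?thesis by blast
qed

lemma tet_hom_unique:
  assumes "lie_hom tet_scale tet_br scale br \<phi>" "lie_hom tet_scale tet_br scale br \<psi>"
    and "\<And>i j. \<phi> (tet_x i j) = \<psi> (tet_x i j)"
  shows "\<phi> = \<psi>"
proof
  fix X :: "'f tet"
  obtain s where "X = abs_tet s" by (metis Quotient3_abs_rep Quotient3_tet)
  moreover have "\<phi> (abs_tet s) = \<psi> (abs_tet s)"
  proof (induction s)
    case (Gen i j)
    then show ?case using assms(3) by (simp add: tet_x_def)
  next
    case Zero
    have "\<phi> 0 = 0" "\<psi> 0 = 0"
      using assms by (auto simp: lie_hom_def Vector_Spaces.linear_def module_hom.zero)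
    then show ?case by (simp add: zero_tet_def)
  next
    case (Add s t)
    then show ?case using assms
      by (simp add: lie_hom_def Vector_Spaces.linear_iff flip: plus_tet.abs_eq)
  next
    case (Scale c s)
    then show ?case using assms
      by (simp add: lie_hom_def Vector_Spaces.linear_iff flip: tet_scale.abs_eq)
  next
    case (Br s t)
    then show ?case using assms
      by (simp add: lie_hom_def flip: tet_br.abs_eq)
  qed
  ultimately show "\<phi> X = \<psi> X" by simp
qed

end


section \<open>The Lie algebra sl2\<close>

typedef (overloaded) 'f sl2 = "{A :: 'f::field^2^2. trace A = 0}"
  by (rule exI[of _ 0]) (simp add: trace_def)

setup_lifting type_definition_sl2

instantiation sl2 :: (field) ab_group_add
begin

lift_definition zero_sl2 :: "'a sl2" is 0 by (simp add: trace_def)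
lift_definition plus_sl2 :: "'a sl2 \<Rightarrow> 'a sl2 \<Rightarrow> 'a sl2" is "(+)" by (simp add: trace_add)
lift_definition uminus_sl2 :: "'a sl2 \<Rightarrow> 'a sl2" is uminus by (simp add: trace_def sum_negf)
lift_definition minus_sl2 :: "'a sl2 \<Rightarrow> 'a sl2 \<Rightarrow> 'a sl2" is "(-)" by (simp add: trace_sub)

instance by standard (transfer; simp)+

end

lift_definition sl2_scale :: "'f::field \<Rightarrow> 'f sl2 \<Rightarrow> 'f sl2" is "\<lambda>c A. \<chi> i j. c * A $ i $ j"
proof -
  fix c :: 'f and A :: "'f^2^2" assume "trace A = 0"
  moreover have "trace (\<chi> i j. c * A $ i $ j) = c * trace A"
    by (simp add: trace_def sum_distrib_left)
  ultimately show "trace (\<chi> i j. c * A $ i $ j) = 0" by simp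
qed
lift_definition sl2_br :: "'f::field sl2 \<Rightarrow> 'f sl2 \<Rightarrow> 'f sl2" is "\<lambda>A B. A ** B - B ** A"
  using trace_sub trace_mul_sym by (metis diff_self)

lift_definition sl2_e :: "'f::field sl2" is "\<chi> i j. if i = 1 \<and> j = 2 then 1 else 0"
  by (simp add: trace_def sum_2)
lift_definition sl2_f :: "'f::field sl2" is "\<chi> i j. if i = 2 \<and> j = 1 then 1 else 0"
  by (simp add: trace_def sum_2)
lift_definition sl2_h :: "'f::field sl2" is
  "\<chi> i j. if i = 1 \<and> j = 1 then 1 else if i = 2 \<and> j = 2 then -1 else 0"
  by (simp add: trace_def sum_2)

lemmas sl2_mat_simps =
  vec_eq_iff forall_2 matrix_matrix_mult_def sum_2 trace_def

lemma sl2_brackets: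
  "sl2_br sl2_h sl2_e = sl2_scale 2 (sl2_e :: 'f::field sl2)"
  "sl2_br sl2_h sl2_f = sl2_scale (-2) (sl2_f :: 'f::field sl2)"
  "sl2_br sl2_e sl2_f = (sl2_h :: 'f::field sl2)"
  by (transfer; simp add: sl2_mat_simps)+

lemma vector_space_sl2: "vector_space (sl2_scale :: 'f::field \<Rightarrow> _)"
  by standard (transfer; simp add: sl2_mat_simps algebra_simps)+

interpretation sl2: lie_algebra "sl2_scale :: 'f::field \<Rightarrow> _" sl2_br
proof (intro lie_algebra.intro lie_algebra_axioms.intro vector_space_sl2)
  fix x y z :: "'f sl2"
  show "Vector_Spaces.linear sl2_scale sl2_scale (\<lambda>y. sl2_br x y)"
    unfolding Vector_Spaces.linear_iff
    by (intro conjI allI vector_space_sl2; transfer) (simp_all add: sl2_mat_simps algebra_simps)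
  show "Vector_Spaces.linear sl2_scale sl2_scale (\<lambda>x. sl2_br x y)"
    unfolding Vector_Spaces.linear_iff
    by (intro conjI allI vector_space_sl2; transfer) (simp_all add: sl2_mat_simps algebra_simps)
  show "sl2_br x x = 0" by transfer simp
  show "sl2_br x (sl2_br y z) + sl2_br y (sl2_br z x) + sl2_br z (sl2_br x y) = 0"
    by transfer (simp add: sl2_mat_simps algebra_simps)
qed

definition sl2_x :: "'f::field sl2" where "sl2_x = sl2_scale 2 sl2_e - sl2_h"
definition sl2_y :: "'f::field sl2" where "sl2_y = sl2_scale (-2) sl2_f - sl2_h"
definition sl2_z :: "'f::field sl2" where "sl2_z = sl2_h"


section \<open>Evaluation modules\<close>

definition is_EV :: "'f::field \<Rightarrow> ('f tet \<Rightarrow> 'f sl2) \<Rightarrow> bool" where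
  "is_EV a \<phi> \<longleftrightarrow> lie_hom tet_scale tet_br sl2_scale sl2_br \<phi> \<and>
     \<phi> (tet_x I1 I2) = sl2_x \<and>
     \<phi> (tet_x I2 I3) = sl2_y \<and>
     \<phi> (tet_x I3 I1) = sl2_z \<and>
     \<phi> (tet_x I0 I3) = sl2_scale a sl2_y + sl2_scale (a - 1) sl2_z \<and>
     \<phi> (tet_x I0 I1) = sl2_scale (1 - inverse a) sl2_z - sl2_scale (inverse a) sl2_x \<and>
     \<phi> (tet_x I0 I2) = sl2_scale (inverse (1 - a)) sl2_x + sl2_scale (a * inverse (1 - a)) sl2_y"

definition EV :: "'f::field \<Rightarrow> 'f tet \<Rightarrow> 'f sl2" where
  "EV a = (THE \<phi>. is_EV a \<phi>)"


text \<open>Coordinates on sl2 reduce the defining relations to field identities.\<close>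

lift_definition sl2_mk :: "'f::field \<Rightarrow> 'f \<Rightarrow> 'f \<Rightarrow> 'f sl2" is
  "\<lambda>p q r. \<chi> i j. if i = 1 then (if j = 1 then p else q) else (if j = 1 then r else - p)"
  by (simp add: trace_def sum_2)

lemma sl2_mk_simps:
  fixes p q r p' q' r' c :: "'f::field"
  shows "sl2_mk p q r + sl2_mk p' q' r' = sl2_mk (p + p') (q + q') (r + r')"
    and "sl2_mk p q r - sl2_mk p' q' r' = sl2_mk (p - p') (q - q') (r - r')"
    and "- sl2_mk p q r = sl2_mk (- p) (- q) (- r)"
    and "sl2_scale c (sl2_mk p q r) = sl2_mk (c * p) (c * q) (c * r)"
    and "sl2_br (sl2_mk p q r) (sl2_mk p' q' r') =
      sl2_mk (q * r' - q' * r) (2 * (p * q' - q * p')) (2 * (r * p' - p * r'))"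
    and "sl2_mk p q r = sl2_mk p' q' r' \<longleftrightarrow> p = p' \<and> q = q' \<and> r = r'"
  by (transfer; auto simp: sl2_mat_simps algebra_simps)+

lemma sl2_as_mk:
  "0 = sl2_mk 0 0 (0 :: 'f::field)"
  "sl2_e = sl2_mk 0 1 (0 :: 'f::field)"
  "sl2_f = sl2_mk 0 0 (1 :: 'f::field)"
  "sl2_h = sl2_mk 1 0 (0 :: 'f::field)"
  by (transfer; simp add: sl2_mat_simps)+

text \<open>Existence and uniqueness of the evaluation homomorphism.\<close>

fun EV_gen :: "'f::field \<Rightarrow> idx \<Rightarrow> idx \<Rightarrow> 'f sl2" where
  "EV_gen a I1 I2 = sl2_x"
| "EV_gen a I2 I3 = sl2_y"
| "EV_gen a I3 I1 = sl2_z"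
| "EV_gen a I0 I3 = sl2_scale a sl2_y + sl2_scale (a - 1) sl2_z"
| "EV_gen a I0 I1 = sl2_scale (1 - inverse a) sl2_z - sl2_scale (inverse a) sl2_x"
| "EV_gen a I0 I2 = sl2_scale (inverse (1 - a)) sl2_x + sl2_scale (a * inverse (1 - a)) sl2_y"
| "EV_gen a I2 I1 = - sl2_x"
| "EV_gen a I3 I2 = - sl2_y"
| "EV_gen a I1 I3 = - sl2_z"
| "EV_gen a I3 I0 = - (sl2_scale a sl2_y + sl2_scale (a - 1) sl2_z)"
| "EV_gen a I1 I0 = - (sl2_scale (1 - inverse a) sl2_z - sl2_scale (inverse a) sl2_x)"
| "EV_gen a I2 I0 = - (sl2_scale (inverse (1 - a)) sl2_x + sl2_scale (a * inverse (1 - a)) sl2_y)"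
| "EV_gen a I0 I0 = 0"
| "EV_gen a I1 I1 = 0"
| "EV_gen a I2 I2 = 0"
| "EV_gen a I3 I3 = 0"

lemma is_EV_iff:
  "is_EV a \<phi> \<longleftrightarrow> lie_hom tet_scale tet_br sl2_scale sl2_br \<phi> \<and> (\<forall>i j. \<phi> (tet_x i j) = EV_gen a i j)"
proof
  assume L: "is_EV a \<phi>"
  then have hom: "lie_hom tet_scale tet_br sl2_scale sl2_br \<phi>" by (simp add: is_EV_def)
  then have add: "\<phi> (u + v) = \<phi> u + \<phi> v" and zero: "\<phi> 0 = 0" for u v
    by (auto simp: lie_hom_def Vector_Spaces.linear_def module_hom.add module_hom.zero)
  have skew: "\<phi> (tet_x j i) = - \<phi> (tet_x i j)" if "i \<noteq> j" for i j
  proof -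
    have "tet_x i j + tet_x j i = (0 :: 'a tet)"
      using that by transfer (rule tet_eq.Rel_i)
    then show ?thesis by (metis add zero add_eq_0_iff)
  qed
  have diag: "\<phi> (tet_x i i) = 0" for i
  proof -
    have "tet_x i i = (0 :: 'a tet)" by transfer (rule tet_eq.Gen_junk)
    then show ?thesis by (simp add: zero)
  qed
  have "\<phi> (tet_x i j) = EV_gen a i j" for i j
    using L diag skew[of I1 I2] skew[of I2 I3] skew[of I3 I1] skew[of I0 I3] skew[of I0 I1]
      skew[of I0 I2]
    by (cases i; cases j) (simp_all add: is_EV_def)
  with hom show "lie_hom tet_scale tet_br sl2_scale sl2_br \<phi> \<and> (\<forall>i j. \<phi> (tet_x i j) = EV_gen a i j)"
    by blast
qed (simp add: is_EV_def)

lemma sl2_ad_cube: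
  fixes p q r :: "'f::field"
  assumes "p * p + q * r = 1"
  shows "sl2_br (sl2_mk p q r) (sl2_br (sl2_mk p q r) (sl2_br (sl2_mk p q r) (sl2_mk p' q' r'))) =
    sl2_scale 4 (sl2_br (sl2_mk p q r) (sl2_mk p' q' r'))"
  unfolding sl2_mk_simps using assms by (intro conjI; algebra)

lemma sl2_mk_exhaust: "\<exists>p q r. A = sl2_mk p q r"
proof transfer
  fix A :: "'a^2^2"
  assume "trace A = 0"
  then show "\<exists>p q r. A = (\<chi> i j. if i = 1 then (if j = 1 then p else q) else (if j = 1 then r else - p))"
    by (intro exI[of _ "A $ 1 $ 1"] exI[of _ "A $ 1 $ 2"] exI[of _ "A $ 2 $ 1"])
      (simp add: sl2_mat_simps eq_neg_iff_add_eq_0 add.commute)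
qed

lemma EV_gen_mk:
  fixes a :: "'f::field"
  shows
  "EV_gen a I1 I2 = sl2_mk (-1) 2 0"
  "EV_gen a I2 I3 = sl2_mk (-1) 0 (-2)"
  "EV_gen a I3 I1 = sl2_mk 1 0 0"
  "EV_gen a I0 I3 = sl2_mk (-1) 0 (-2 * a)"
  "EV_gen a I0 I1 = sl2_mk 1 (-2 * inverse a) 0"
  "EV_gen a I0 I2 = sl2_mk (- (1 + a) * inverse (1 - a)) (2 * inverse (1 - a)) (-2 * a * inverse (1 - a))"
  "EV_gen a I2 I1 = sl2_mk 1 (-2) 0"
  "EV_gen a I3 I2 = sl2_mk 1 0 2"
  "EV_gen a I1 I3 = sl2_mk (-1) 0 0"
  "EV_gen a I3 I0 = sl2_mk 1 0 (2 * a)"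
  "EV_gen a I1 I0 = sl2_mk (-1) (2 * inverse a) 0"
  "EV_gen a I2 I0 = sl2_mk ((1 + a) * inverse (1 - a)) (-2 * inverse (1 - a)) (2 * a * inverse (1 - a))"
  by (simp_all add: sl2_x_def sl2_y_def sl2_z_def sl2_as_mk sl2_mk_simps algebra_simps)

lemma EV_unique:
  fixes a :: "'f::field"
  assumes "a \<noteq> 0" "a \<noteq> 1"
  shows "\<exists>!\<phi>. is_EV a \<phi>"
proof -
  define b c where "b = inverse (1 - a)" and "c = inverse a"
  have "a * b = b - 1" "a * c = 1" "b * c = b + c"
    using assms by (simp_all add: b_def c_def field_simps)
  then have bc: "a * b = b - 1" "a * (b * u) = b * u - u" "a * c = 1" "a * (c * u) = u"
    "b * c = b + c" "b * (c * u) = b * u + c * u" for u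
    by (simp_all add: mult.assoc[symmetric] left_diff_distrib distrib_right)
  note gens = EV_gen_mk[of a, folded b_def c_def]
  have "\<exists>\<phi>. lie_hom tet_scale tet_br sl2_scale sl2_br \<phi> \<and> (\<forall>i j. \<phi> (tet_x i j) = EV_gen a i j)"
  proof (rule sl2.tet_universal)
    show "EV_gen a i i = 0" for i by (cases i) simp_all
    show "EV_gen a i j + EV_gen a j i = 0" if "i \<noteq> j" for i j
      using that by (cases i; cases j) (simp_all del: EV_gen.simps add: gens sl2_mk_simps sl2_as_mk algebra_simps)
    show "sl2_br (EV_gen a i j) (EV_gen a j k) =
        sl2_scale 2 (EV_gen a i j) + sl2_scale 2 (EV_gen a j k)" if d: "distinct [i, j, k]" for i j k
      by (cases i; cases j; cases k; use d in \<open>simp_all only: distinct.simps list.set insert_iff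
           idx.distinct empty_iff simp_thms gens sl2_mk_simps\<close>)
         (simp_all add: algebra_simps bc)
    show "sl2_br (EV_gen a i j) (sl2_br (EV_gen a i j) (sl2_br (EV_gen a i j) (EV_gen a k l))) =
        sl2_scale 4 (sl2_br (EV_gen a i j) (EV_gen a k l))" if d: "distinct [i, j, k, l]" for i j k l
    proof -
      have "\<exists>p q r. EV_gen a i j = sl2_mk p q r \<and> p * p + q * r = 1"
        by (cases i; cases j; use d in \<open>simp_all only: distinct.simps list.set insert_iff
             idx.distinct empty_iff simp_thms gens\<close>)
           (rule exI, rule exI, rule exI, rule conjI[OF refl], simp add: algebra_simps bc)+
      with sl2_mk_exhaust[of "EV_gen a k l"] show ?thesis by (auto simp: sl2_ad_cube)
    qed
  qed
  then show ?thesis unfolding is_EV_iff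
    by (metis sl2.tet_hom_unique)
qed

lemma is_EV_EV: "a \<noteq> 0 \<Longrightarrow> a \<noteq> 1 \<Longrightarrow> is_EV a (EV a)"
  using theI'[OF EV_unique[of a]] by (simp add: EV_def)

definition eval_act :: "'f::field \<Rightarrow> ('f sl2 \<Rightarrow> 'v \<Rightarrow> 'v) \<Rightarrow> 'f tet \<Rightarrow> 'v \<Rightarrow> 'v" where
  "eval_act a \<rho> \<xi> v = \<rho> (EV a \<xi>) v"

lemma lie_module_eval_act:
  assumes "a \<noteq> 0" "a \<noteq> 1" "lie_module sl2_scale sl2_br sc \<rho>"
  shows "lie_module tet_scale tet_br sc (eval_act a \<rho>)"
proof -
  interpret M: lie_module sl2_scale sl2_br sc \<rho> by fact
  have hom: "lie_hom tet_scale tet_br sl2_scale sl2_br (EV a)"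
    using is_EV_EV[of a] assms by (simp add: is_EV_def)
  then have EV_br: "EV a (tet_br X Y) = sl2_br (EV a X) (EV a Y)" for X Y
    by (simp add: lie_hom_def)
  have "Vector_Spaces.linear tet_scale sc ((\<lambda>x. \<rho> x v) \<circ> EV a)" for v
    using hom M.act_linear_left[of v] unfolding lie_hom_def
    by (auto intro: Vector_Spaces.linear_compose)
  then have "Vector_Spaces.linear tet_scale sc (\<lambda>x. eval_act a \<rho> x v)" for v
    by (simp add: eval_act_def o_def)
  moreover have "Vector_Spaces.linear sc sc (\<lambda>v. eval_act a \<rho> x v)" for x
    unfolding eval_act_def by (rule M.act_linear_right)
  ultimately show ?thesis
    by (intro lie_module.intro lie_module_axioms.intro tet.lie_algebra_axioms M.V.vector_space_axioms)
      (simp_all add: eval_act_def EV_br M.act_br)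
qed


section \<open>Decompositions, flags, forms and bases\<close>

definition decomp_comp ::
  "('f::field \<Rightarrow> 'v::ab_group_add \<Rightarrow> 'v) \<Rightarrow> ('f tet \<Rightarrow> 'v \<Rightarrow> 'v) \<Rightarrow> nat \<Rightarrow> idx \<Rightarrow> idx \<Rightarrow> nat \<Rightarrow> 'v set" where
  "decomp_comp sc act d k l n = {v. act (tet_x k l) v = sc (2 * of_nat n - of_nat d) v}"

text \<open>On \<open>V\<^sub>d(a)\<close> the flag \<open>[i]\<close> does not depend on the choice of \<open>j \<noteq> i\<close>, so an
  arbitrary one is picked.\<close>

definition flag_comp ::
  "('f::field \<Rightarrow> 'v::ab_group_add \<Rightarrow> 'v) \<Rightarrow> ('f tet \<Rightarrow> 'v \<Rightarrow> 'v) \<Rightarrow> nat \<Rightarrow> idx \<Rightarrow> nat \<Rightarrow> 'v set" where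
  "flag_comp sc act d i n = (let j = (SOME j. j \<noteq> i) in
     {\<Sum>m\<le>n. w m | w. \<forall>m\<le>n. w m \<in> decomp_comp sc act d i j m})"

definition standard_form ::
  "('f::field \<Rightarrow> 'v::ab_group_add \<Rightarrow> 'v) \<Rightarrow> ('f tet \<Rightarrow> 'v \<Rightarrow> 'v) \<Rightarrow> ('v \<Rightarrow> 'v \<Rightarrow> 'f) \<Rightarrow> bool" where
  "standard_form sc act B \<longleftrightarrow>
     (\<forall>u. Vector_Spaces.linear sc (*) (\<lambda>v. B u v)) \<and>
     (\<forall>v. Vector_Spaces.linear sc (*) (\<lambda>u. B u v)) \<and>
     (\<exists>u v. B u v \<noteq> 0) \<and>
     (\<forall>\<xi> u v. B (act \<xi> u) v = - B u (act \<xi> v))"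

text \<open>A basis \<open>u\<^sub>0, \<dots>, u\<^sub>d\<close> is a sequence \<open>nat \<Rightarrow> 'v\<close> of which only the
  entries up to \<open>d\<close> matter.\<close>

definition basis_seq :: "('f::field \<Rightarrow> 'v::ab_group_add \<Rightarrow> 'v) \<Rightarrow> nat \<Rightarrow> (nat \<Rightarrow> 'v) \<Rightarrow> bool" where
  "basis_seq sc d u \<longleftrightarrow> inj_on u {..d} \<and> \<not> module.dependent sc (u ` {..d}) \<and>
     module.span sc (u ` {..d}) = UNIV"

text \<open>The index \<open>j\<close> is determined by the other three and only present for the notation
  \<open>[i, j, k, l]\<close>. The entries beyond \<open>d\<close> are normalised to 0 to make the sequence unique.\<close>

definition tet_basis ::
  "('f::field \<Rightarrow> 'v::ab_group_add \<Rightarrow> 'v) \<Rightarrow> ('f tet \<Rightarrow> 'v \<Rightarrow> 'v) \<Rightarrow> nat \<Rightarrow> (idx \<Rightarrow> 'v) \<Rightarrow>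
   idx \<Rightarrow> idx \<Rightarrow> idx \<Rightarrow> idx \<Rightarrow> nat \<Rightarrow> 'v" where
  "tet_basis sc act d \<eta> i j k l = (THE u. basis_seq sc d u \<and>
     (\<forall>n\<le>d. u n \<in> decomp_comp sc act d k l n) \<and>
     \<eta> i = (\<Sum>n\<le>d. u n) \<and> (\<forall>n>d. u n = 0))"

text \<open>Only the entries \<open>T p q\<close> with \<open>p, q \<le> d\<close> matter.\<close>

definition is_transition_matrix ::
  "('f::field \<Rightarrow> 'v::ab_group_add \<Rightarrow> 'v) \<Rightarrow> nat \<Rightarrow> (nat \<Rightarrow> 'v) \<Rightarrow> (nat \<Rightarrow> 'v) \<Rightarrow> (nat \<Rightarrow> nat \<Rightarrow> 'f) \<Rightarrow> bool" where
  "is_transition_matrix sc d u v T \<longleftrightarrow> basis_seq sc d u \<and> basis_seq sc d v \<and>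
     (\<forall>q\<le>d. v q = (\<Sum>p\<le>d. sc (T p q) (u p)))"

section \<open>Relatives\<close>

text \<open>The product in \<open>BijGroup UNIV\<close> is composition from right to left. The three conditions on
  transpositions determine the action, see \<open>is_S4_action_unique\<close> below.\<close>

definition is_S4_action :: "((idx \<Rightarrow> idx) \<Rightarrow> 'f::field \<Rightarrow> 'f) \<Rightarrow> bool" where
  "is_S4_action \<phi> \<longleftrightarrow> group_action (BijGroup (UNIV :: idx set)) (- {0, 1}) \<phi> \<and>
     (\<forall>a. a \<noteq> 0 \<and> a \<noteq> 1 \<longrightarrow>
        \<phi> (Transposition.transpose I2 I0) a = inverse a \<and>
        \<phi> (Transposition.transpose I0 I1) a = a * inverse (a - 1) \<and>
        \<phi> (Transposition.transpose I1 I3) a = inverse a)"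

definition S4_act :: "(idx \<Rightarrow> idx) \<Rightarrow> 'f::field \<Rightarrow> 'f" where
  "S4_act = (SOME \<phi>. is_S4_action \<phi>)"

definition relative :: "idx \<Rightarrow> idx \<Rightarrow> idx \<Rightarrow> idx \<Rightarrow> 'f::field \<Rightarrow> 'f" where
  "relative i j k l a =
     S4_act (THE \<sigma>. bij \<sigma> \<and> \<sigma> i = I2 \<and> \<sigma> j = I0 \<and> \<sigma> k = I1 \<and> \<sigma> l = I3) a"

text \<open>Existence and uniqueness of the action, via the cross ratio.\<close>

fun cr_form :: "'f::field \<Rightarrow> idx \<Rightarrow> idx \<Rightarrow> 'f" where
  "cr_form a I0 I1 = a" | "cr_form a I1 I0 = a" | "cr_form a I2 I3 = a" | "cr_form a I3 I2 = a"
| "cr_form a I0 I3 = -1" | "cr_form a I3 I0 = -1" | "cr_form a I1 I2 = -1" | "cr_form a I2 I1 = -1"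
| "cr_form a I0 I2 = 1 - a" | "cr_form a I2 I0 = 1 - a" | "cr_form a I1 I3 = 1 - a" | "cr_form a I3 I1 = 1 - a"
| "cr_form a I0 I0 = 0" | "cr_form a I1 I1 = 0" | "cr_form a I2 I2 = 0" | "cr_form a I3 I3 = 0"

definition cr_val :: "idx \<Rightarrow> idx \<Rightarrow> idx \<Rightarrow> 'f::field \<Rightarrow> 'f" where
  "cr_val j k l a = - cr_form a j k / cr_form a j l"

definition cr_act :: "(idx \<Rightarrow> idx) \<Rightarrow> 'f::field \<Rightarrow> 'f" where
  "cr_act \<sigma> = restrict (cr_val (inv_into UNIV \<sigma> I0) (inv_into UNIV \<sigma> I1) (inv_into UNIV \<sigma> I3)) (- {0, 1})"

lemma cr_form_nz: "a \<noteq> 0 \<Longrightarrow> a \<noteq> 1 \<Longrightarrow> i \<noteq> j \<Longrightarrow> cr_form a i j \<noteq> 0"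
  by (cases i; cases j) simp_all

lemma cr_form_sum: "distinct [i, j, k, l] \<Longrightarrow> cr_form a i j + cr_form a i k + cr_form a i l = 0"
  by (cases i; cases j; cases k; cases l) simp_all

lemma cr_form_sym: "cr_form a i j = cr_form a j i"
  by (cases i; cases j) simp_all

lemma cr_form_opp: "distinct [i, j, k, l] \<Longrightarrow> cr_form a i j = cr_form a k l"
  by (cases i; cases j; cases k; cases l) simp_all

lemma cr_val_nz:
  assumes "a \<noteq> 0" "a \<noteq> 1" "distinct [i, j, k, l]"
  shows "cr_val j k l a \<noteq> 0" "cr_val j k l a \<noteq> 1"
proof -
  have nz: "cr_form a j k \<noteq> 0" "cr_form a j l \<noteq> 0" "cr_form a j i \<noteq> 0"
    using assms cr_form_nz[of a j i] by (auto simp: cr_form_nz)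
  then show "cr_val j k l a \<noteq> 0" by (simp add: cr_val_def)
  have "cr_form a j i + cr_form a j k + cr_form a j l = 0"
    by (rule cr_form_sum) (use assms in auto)
  then have "- cr_form a j k \<noteq> cr_form a j l" using nz
    by (metis add.assoc add.commute add.right_inverse add.right_neutral)
  then show "cr_val j k l a \<noteq> 1"
    unfolding cr_val_def using nonzero_divide_eq_eq[OF nz(2), of "- cr_form a j k" 1] by auto
qed

lemma cr_form_act:
  assumes a: "a \<noteq> 0" "a \<noteq> 1" and t: "bij \<tau>"
  shows "cr_form a (\<tau> i) (\<tau> j) =
    - cr_form a (\<tau> I0) (\<tau> I3) * cr_form (cr_val (\<tau> I0) (\<tau> I1) (\<tau> I3) a) i j"
proof -
  have inj: "inj \<tau>" using t by (rule bij_is_inj)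
  then have d: "distinct [\<tau> I0, \<tau> I1, \<tau> I2, \<tau> I3]" by (simp add: inj_eq)
  let ?w = "\<lambda>i j. cr_form a (\<tau> i) (\<tau> j)"
  have nz: "?w I0 I3 \<noteq> 0" using d a by (simp add: cr_form_nz)
  have sm: "?w I0 I1 + ?w I0 I2 + ?w I0 I3 = 0"
    by (rule cr_form_sum) (use d in auto)
  have opp: "?w I2 I3 = ?w I0 I1" "?w I1 I2 = ?w I0 I3" "?w I1 I3 = ?w I0 I2"
    using d by (auto intro!: cr_form_opp)
  have v: "cr_val (\<tau> I0) (\<tau> I1) (\<tau> I3) a = - ?w I0 I1 / ?w I0 I3" by (simp add: cr_val_def)
  have w02: "?w I0 I2 = - ?w I0 I1 - ?w I0 I3"
  proof -
    have "?w I0 I2 = (?w I0 I1 + ?w I0 I2 + ?w I0 I3) - ?w I0 I1 - ?w I0 I3" by simp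
    then show ?thesis unfolding sm by simp
  qed
  have self: "cr_form a x x = 0" for x by (cases x) simp_all
  show ?thesis
    unfolding v
    by (cases i; cases j)
      (simp_all add: nz opp w02 self cr_form_sym[of a "\<tau> I1" "\<tau> I0"]
        cr_form_sym[of a "\<tau> I2" "\<tau> I0"] cr_form_sym[of a "\<tau> I3" "\<tau> I0"]
        cr_form_sym[of a "\<tau> I2" "\<tau> I1"] cr_form_sym[of a "\<tau> I3" "\<tau> I1"]
        cr_form_sym[of a "\<tau> I3" "\<tau> I2"] distrib_left)
qed

lemma cr_act_comp:
  assumes a: "a \<noteq> 0" "a \<noteq> 1" and t: "bij \<sigma>" "bij \<tau>"
  shows "cr_act (\<sigma> \<circ> \<tau>) a = cr_act \<sigma> (cr_act \<tau> a)"
proof -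
  have bi: "bij (inv_into UNIV \<tau>)" "bij (inv_into UNIV \<sigma>)" using t by (simp_all add: bij_imp_bij_inv)
  then have inj: "inj (inv_into UNIV \<tau>)" "inj (inv_into UNIV \<sigma>)" by (simp_all add: bij_is_inj)
  then have d: "distinct [inv_into UNIV \<tau> I2, inv_into UNIV \<tau> I0, inv_into UNIV \<tau> I1, inv_into UNIV \<tau> I3]"
    by (simp add: inj_eq)
  have nz: "cr_form a (inv_into UNIV \<tau> I0) (inv_into UNIV \<tau> I3) \<noteq> 0"
    using d a by (simp add: cr_form_nz)
  show ?thesis
  proof -
    define b where "b = cr_val (inv_into UNIV \<tau> I0) (inv_into UNIV \<tau> I1) (inv_into UNIV \<tau> I3) a"
    have b: "b \<noteq> 0" "b \<noteq> 1" using cr_val_nz[OF a d] by (simp_all add: b_def)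
    have i: "inv_into UNIV (\<sigma> \<circ> \<tau>) x = inv_into UNIV \<tau> (inv_into UNIV \<sigma> x)" for x
      using t by (simp add: o_inv_distrib)
    define c where "c = cr_form a (inv_into UNIV \<tau> I0) (inv_into UNIV \<tau> I3)"
    have c: "c \<noteq> 0" using nz by (simp add: c_def)
    have f: "cr_form a (inv_into UNIV \<tau> x) (inv_into UNIV \<tau> y) = - c * cr_form b x y" for x y
      unfolding b_def c_def by (rule cr_form_act[OF a bi(1)])
    have "cr_val (inv_into UNIV \<tau> x) (inv_into UNIV \<tau> y) (inv_into UNIV \<tau> z) a = cr_val x y z b" for x y z
      unfolding cr_val_def f using c by simp
    moreover have "cr_val I0 I1 I3 b = b" by (simp add: cr_val_def)
    ultimately show ?thesis using a b by (simp add: cr_act_def i)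
  qed
qed

lemma is_S4_action_cr_act: "is_S4_action (cr_act :: _ \<Rightarrow> 'f::field \<Rightarrow> 'f)"
proof -
  let ?E = "- {0, 1 :: 'f}"
  have maps: "cr_act \<sigma> a \<in> ?E" if "bij \<sigma>" "a \<in> ?E" for \<sigma> a
  proof -
    have "inj (inv_into UNIV \<sigma>)" using that by (simp add: bij_imp_bij_inv bij_is_inj)
    then have "distinct [inv_into UNIV \<sigma> I2, inv_into UNIV \<sigma> I0, inv_into UNIV \<sigma> I1, inv_into UNIV \<sigma> I3]" by (simp add: inj_eq)
    from cr_val_nz[OF _ _ this, of a] that show ?thesis by (simp add: cr_act_def)
  qed
  have id: "cr_act id a = a" if "a \<in> ?E" for a
    using that by (simp add: cr_act_def cr_val_def)
  have inv: "cr_act (inv_into UNIV \<sigma>) (cr_act \<sigma> a) = a" "cr_act \<sigma> (cr_act (inv_into UNIV \<sigma>) a) = a"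
    if "bij \<sigma>" "a \<in> ?E" for \<sigma> a
    using that cr_act_comp[of a "inv_into UNIV \<sigma>" \<sigma>] cr_act_comp[of a \<sigma> "inv_into UNIV \<sigma>"] id[of a]
    by (simp_all add: bij_imp_bij_inv bij_is_inj bij_is_surj surj_iff[THEN iffD1])
  have bij: "cr_act \<sigma> \<in> Bij ?E" if "bij \<sigma>" for \<sigma>
  proof -
    have "bij_betw (cr_act \<sigma>) ?E ?E"
    proof (rule bij_betw_byWitness[where f' = "cr_act (inv_into UNIV \<sigma>)"])
      have bi: "bij (inv_into UNIV \<sigma>)" using that by (rule bij_imp_bij_inv)
      show "\<forall>a\<in>?E. cr_act (inv_into UNIV \<sigma>) (cr_act \<sigma> a) = a" using inv(1)[OF that] by (intro ballI)
      show "\<forall>a\<in>?E. cr_act \<sigma> (cr_act (inv_into UNIV \<sigma>) a) = a" using inv(2)[OF that] by (intro ballI)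
      show "cr_act \<sigma> ` ?E \<subseteq> ?E" using maps[OF that] by (intro image_subsetI)
      show "cr_act (inv_into UNIV \<sigma>) ` ?E \<subseteq> ?E" using maps[OF bi] by (intro image_subsetI)
    qed
    then show ?thesis by (simp add: Bij_def cr_act_def)
  qed
  have "group_action (BijGroup (UNIV :: idx set)) ?E cr_act"
  proof (intro group_action.intro group_hom.intro group_hom_axioms.intro group_BijGroup homI)
    fix \<sigma> \<tau> :: "idx \<Rightarrow> idx"
    assume "\<sigma> \<in> carrier (BijGroup UNIV)" "\<tau> \<in> carrier (BijGroup UNIV)"
    then have st: "bij \<sigma>" "bij \<tau>" by (simp_all add: BijGroup_def Bij_def)
    then show "cr_act \<sigma> \<in> carrier (BijGroup ?E)" by (simp add: BijGroup_def bij)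
    have "compose UNIV \<sigma> \<tau> = \<sigma> \<circ> \<tau>" by (simp add: compose_def fun_eq_iff)
    moreover have "cr_act (\<sigma> \<circ> \<tau>) = compose ?E (cr_act \<sigma>) (cr_act \<tau>)"
    proof
      fix a
      show "cr_act (\<sigma> \<circ> \<tau>) a = compose ?E (cr_act \<sigma>) (cr_act \<tau>) a"
      proof (cases "a \<in> ?E")
        case True
        then show ?thesis using cr_act_comp[of a \<sigma> \<tau>] st by (simp add: compose_def)
      next
        case False
        then show ?thesis by (simp add: compose_def cr_act_def)
      qed
    qed
    ultimately show "cr_act (\<sigma> \<otimes>\<^bsub>BijGroup UNIV\<^esub> \<tau>) =
        cr_act \<sigma> \<otimes>\<^bsub>BijGroup ?E\<^esub> cr_act \<tau>"
      using st bij by (simp add: BijGroup_def Bij_def)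
  qed
  moreover have "inverse a = - 1 / - a" if "a \<noteq> 0" for a :: 'f using that by (simp add: field_simps)
  ultimately show ?thesis
    unfolding is_S4_action_def
    by (auto simp: cr_act_def cr_val_def Transposition.transpose_def field_simps)
qed

lemma is_S4_action_S4_act: "is_S4_action S4_act"
  unfolding S4_act_def using someI[of is_S4_action, OF is_S4_action_cr_act] by simp

lemma is_S4_action_unique:
  fixes \<phi> \<psi> :: "(idx \<Rightarrow> idx) \<Rightarrow> 'f::field \<Rightarrow> 'f"
  assumes "is_S4_action \<phi>" "is_S4_action \<psi>" "bij \<sigma>" "a \<noteq> 0" "a \<noteq> 1"
  shows "\<phi> \<sigma> a = \<psi> \<sigma> a"
proof -
  let ?E = "- {0, 1 :: 'f}" and ?G = "BijGroup (UNIV :: idx set)"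
  have comp: "f (\<sigma> \<circ> \<tau>) b = f \<sigma> (f \<tau> b)" and closed: "f \<tau> b \<in> ?E"
    and one: "f id b = b"
    if f: "is_S4_action f" and st: "bij \<sigma>" "bij \<tau>" and b: "b \<in> ?E" for f \<sigma> \<tau> b
  proof -
    interpret group_action ?G ?E f using f by (simp add: is_S4_action_def)
    have car: "\<sigma> \<in> carrier ?G" "\<tau> \<in> carrier ?G" using st by (simp_all add: BijGroup_def Bij_def)
    have "\<sigma> \<otimes>\<^bsub>?G\<^esub> \<tau> = \<sigma> \<circ> \<tau>"
      using car by (simp add: BijGroup_def compose_def fun_eq_iff)
    then show "f (\<sigma> \<circ> \<tau>) b = f \<sigma> (f \<tau> b)"
      using composition_rule[OF b car] by simp
    show "f \<tau> b \<in> ?E" using element_image[OF car(2) b refl] .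
    have "\<one>\<^bsub>?G\<^esub> = id" by (simp add: BijGroup_def fun_eq_iff)
    then show "f id b = b" using id_eq_one b by (metis restrict_apply')
  qed
  define P where "P \<sigma> \<longleftrightarrow> bij \<sigma> \<and> (\<forall>b\<in>?E. \<phi> \<sigma> b = \<psi> \<sigma> b)" for \<sigma>
  have P_comp: "P (\<sigma> \<circ> \<tau>)" if "P \<sigma>" "P \<tau>" for \<sigma> \<tau>
  proof -
    have "bij (\<sigma> \<circ> \<tau>)" using that by (simp add: P_def bij_comp)
    moreover have "\<phi> (\<sigma> \<circ> \<tau>) b = \<psi> (\<sigma> \<circ> \<tau>) b" if b: "b \<in> ?E" for b
    proof -
      have st: "bij \<sigma>" "bij \<tau>" using \<open>P \<sigma>\<close> \<open>P \<tau>\<close> by (simp_all add: P_def)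
      have "\<phi> \<tau> b = \<psi> \<tau> b" using \<open>P \<tau>\<close> b unfolding P_def by blast
      moreover have "\<phi> \<sigma> (\<psi> \<tau> b) = \<psi> \<sigma> (\<psi> \<tau> b)"
        using \<open>P \<sigma>\<close> closed[OF assms(2) st b] unfolding P_def by blast
      ultimately show ?thesis
        unfolding comp[OF assms(1) st b] comp[OF assms(2) st b] by simp
    qed
    ultimately show ?thesis by (simp add: P_def)
  qed
  let ?t = "Transposition.transpose :: idx \<Rightarrow> _"
  have gens: "P (?t I2 I0)" "P (?t I0 I1)" "P (?t I1 I3)"
    using assms(1,2) by (auto simp: P_def is_S4_action_def)
  have conj: "?t I1 I2 = ?t I0 I1 \<circ> ?t I2 I0 \<circ> ?t I0 I1"
    "?t I0 I3 = ?t I0 I1 \<circ> ?t I1 I3 \<circ> ?t I0 I1"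
    "?t I2 I3 = ?t I2 I0 \<circ> ?t I0 I3 \<circ> ?t I2 I0"
    by (auto simp: fun_eq_iff Transposition.transpose_def)
  have P_id: "P id" using one[OF assms(1) assms(3,3)] one[OF assms(2) assms(3,3)] by (simp add: P_def)
  have P12: "P (?t I1 I2)" unfolding conj(1) by (intro P_comp gens)
  have P03: "P (?t I0 I3)" unfolding conj(2) by (intro P_comp gens)
  have P23: "P (?t I2 I3)" unfolding conj(3) by (intro P_comp gens P03)
  have P_t: "P (?t i j)" for i j
  proof -
    have *: "?t x y = ?t y x" for x y by (rule transpose_commute)
    show ?thesis
      using gens P12 P03 P23 P_id
        gens(1)[unfolded *[of I2 I0]] gens(2)[unfolded *[of I0 I1]] gens(3)[unfolded *[of I1 I3]]
        P12[unfolded *[of I1 I2]] P03[unfolded *[of I0 I3]] P23[unfolded *[of I2 I3]]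
      by (cases i; cases j; simp only: transpose_same)
  qed
  have "(UNIV :: idx set) = {I0, I1, I2, I3}" using idx.exhaust by auto
  then have fin: "finite (UNIV :: idx set)" by (metis finite.emptyI finite.insertI)
  have perm: "\<sigma> permutes UNIV" using assms(3) by (simp add: permutes_def bij_iff)
  have "P \<sigma>"
    using perm fin P_id
  proof (rule permutes_induct)
    show "P (?t i j \<circ> p)" if "P p" for i j p using P_comp[OF P_t that] .
  qed
  then show ?thesis using assms(4,5) by (simp add: P_def)
qed

lemma relative_eq:
  assumes "a \<noteq> 0" "a \<noteq> 1" "distinct [i, j, k, l]"
  shows "relative i j k l a = - cr_form a j k / cr_form a j l"
proof -
  define \<sigma> where "\<sigma> x = (if x = i then I2 else if x = j then I0 else if x = k then I1 else I3)" for x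
  have ex: "x = i \<or> x = j \<or> x = k \<or> x = l" for x
    using assms(3) by (cases i; cases j; cases k; cases l; cases x) simp_all
  have inj: "inj \<sigma>"
    by (rule injI) (use ex in \<open>auto simp: \<sigma>_def split: if_splits\<close>)
  have "surj \<sigma>"
    unfolding surj_def
  proof
    fix y show "\<exists>x. y = \<sigma> x"
      by (cases y; use assms(3) in \<open>force simp: \<sigma>_def\<close>)
  qed
  with inj have bij: "bij \<sigma>" by (simp add: bij_def)
  have vals: "\<sigma> i = I2" "\<sigma> j = I0" "\<sigma> k = I1" "\<sigma> l = I3"
    using assms(3) by (auto simp: \<sigma>_def)
  have "(THE \<sigma>. bij \<sigma> \<and> \<sigma> i = I2 \<and> \<sigma> j = I0 \<and> \<sigma> k = I1 \<and> \<sigma> l = I3) = \<sigma>"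
  proof (rule the_equality)
    show "bij \<sigma> \<and> \<sigma> i = I2 \<and> \<sigma> j = I0 \<and> \<sigma> k = I1 \<and> \<sigma> l = I3" using bij vals by simp
  next
    fix \<tau> assume \<tau>: "bij \<tau> \<and> \<tau> i = I2 \<and> \<tau> j = I0 \<and> \<tau> k = I1 \<and> \<tau> l = I3"
    show "\<tau> = \<sigma>"
    proof
      fix x
      show "\<tau> x = \<sigma> x" using ex[of x] vals \<tau> by (elim disjE) simp_all
    qed
  qed
  moreover have "S4_act \<sigma> a = cr_act \<sigma> a"
    by (rule is_S4_action_unique[OF is_S4_action_S4_act is_S4_action_cr_act bij assms(1,2)])
  moreover have "inv_into UNIV \<sigma> I0 = j" "inv_into UNIV \<sigma> I1 = k" "inv_into UNIV \<sigma> I3 = l"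
    using inv_f_eq[OF inj vals(2)] inv_f_eq[OF inj vals(3)] inv_f_eq[OF inj vals(4)] by simp_all
  ultimately show ?thesis
    using assms by (simp add: relative_def cr_act_def cr_val_def)
qed
end

theory Submission
  imports Defs
begin

text \<open>In a weight basis, \<open>V\<^sub>d\<close> is the space of homogeneous polynomials of degree \<open>d\<close> in two
  variables. Every \<open>x\<^sub>i\<^sub>j\<close> acts through a \<open>2 \<times> 2\<close> matrix with eigenvalues \<open>-1\<close>, \<open>1\<close>, and the
  corresponding eigenvectors are linear forms \<open>L\<^sub>i\<close>, \<open>L\<^sub>j\<close> that depend on one index each. Hence component \<open>n\<close> of
  \<open>[k, l]\<close> is spanned by \<open>L\<^sub>k\<^bsup>d-n\<^esup> L\<^sub>l\<^sup>n\<close>, and \<open>\<eta>\<^sub>i\<close> is a multiple of \<open>L\<^sub>i\<^sup>d\<close>. If \<open>L\<^sub>i = P + Q\<close> with \<open>P\<close>, \<open>Q\<close>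
  multiples of \<open>L\<^sub>k\<close>, \<open>L\<^sub>l\<close>, then the basis \<open>[i, j, k, l]\<close> consists of the terms of the binomial
  expansion of \<open>(P + Q)\<^sup>d\<close>, and \<open>L\<^sub>j\<close> is a multiple of \<open>P + \<alpha> Q\<close>. The three matrices express the
  rescaling of \<open>P\<close>, \<open>Q\<close> to \<open>P\<close>, \<open>\<alpha> Q\<close>, the decomposition \<open>P + Q = (P + \<alpha> Q) + (1 - \<alpha>) Q\<close>, and the
  exchange of \<open>P\<close> and \<open>Q\<close>.\<close>

section \<open>Eigenvectors and bases\<close>

context vector_space
begin

text \<open>Applying \<open>T - \<mu> b\<close> removes the term at \<open>b\<close> and multiplies
  each other term by the nonzero scalar \<open>\<mu> n - \<mu> b\<close>, so induction applies. The
  \<open>v n\<close> may vanish, which lets differences of eigenvectors be compared.\<close>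

lemma eigenvectors_sum_zero:
  assumes T: "Vector_Spaces.linear scale scale T"
    and "finite S" "inj_on \<mu> S"
    and "\<And>n. n \<in> S \<Longrightarrow> T (v n) = scale (\<mu> n) (v n)"
    and "(\<Sum>n\<in>S. v n) = 0" "m \<in> S"
  shows "v m = 0"
proof -
  interpret T: module_hom scale scale T using T by (simp add: Vector_Spaces.linear_def)
  show ?thesis
    using assms(2-)
  proof (induction S arbitrary: v m rule: finite_induct)
    case (insert b S)
    let ?u = "\<lambda>n. scale (\<mu> n - \<mu> b) (v n)"
    have "(\<Sum>n\<in>insert b S. T (v n) - scale (\<mu> b) (v n)) = T (\<Sum>n\<in>insert b S. v n) - scale (\<mu> b) (\<Sum>n\<in>insert b S. v n)"
      by (simp only: sum_subtractf T.sum scale_sum_right)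
    then have "(\<Sum>n\<in>insert b S. T (v n) - scale (\<mu> b) (v n)) = 0"
      using insert.prems by (simp add: T.zero)
    moreover have "T (v n) - scale (\<mu> b) (v n) = ?u n" if "n \<in> insert b S" for n
      unfolding insert.prems(2)[OF that] by (simp add: scale_left_diff_distrib)
    ultimately have "(\<Sum>n\<in>insert b S. ?u n) = 0" by simp
    then have sum0: "(\<Sum>n\<in>S. ?u n) = 0" using insert.hyps by simp
    have Tu: "T (?u n) = scale (\<mu> n) (?u n)" if "n \<in> S" for n
      using insert.prems(2)[of n] that by (simp add: T.scale mult.commute)
    have inj: "inj_on \<mu> S" using insert.prems(1) by simp
    have u0: "?u n = 0" if "n \<in> S" for n
      using insert.IH[of ?u n] inj Tu sum0 that by blast
    have S: "v n = 0" if "n \<in> S" for n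
    proof -
      have "\<mu> n \<noteq> \<mu> b" using insert.prems(1) insert.hyps that by (auto simp: inj_on_def)
      then show ?thesis using u0[OF that] by (simp add: scale_eq_0_iff)
    qed
    then have "v b = 0" using insert.prems(3) insert.hyps by simp
    with S insert.prems(4) show ?case by blast
  qed simp
qed

lemma eigenvectors_independent:
  assumes T: "Vector_Spaces.linear scale scale T"
    and S: "finite S" "inj_on \<mu> S"
    and v: "\<And>n. n \<in> S \<Longrightarrow> T (v n) = scale (\<mu> n) (v n)" "\<And>n. n \<in> S \<Longrightarrow> v n \<noteq> 0"
  shows "inj_on v S" "independent (v ` S)"
proof -
  interpret T: module_hom scale scale T using T by (simp add: Vector_Spaces.linear_def)
  show inj: "inj_on v S"
  proof (rule inj_onI)
    fix m n assume mn: "m \<in> S" "n \<in> S" "v m = v n"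
    then have "scale (\<mu> m) (v n) = scale (\<mu> n) (v n)" using v(1) by metis
    then have "\<mu> m = \<mu> n" using v(2)[OF mn(2)] scale_right_imp_eq by blast
    then show "m = n" using S(2) mn by (simp add: inj_on_def)
  qed
  show "independent (v ` S)"
  proof (rule independent_if_scalars_zero)
    fix f x assume sum: "(\<Sum>x\<in>v ` S. scale (f x) x) = 0" and "x \<in> v ` S"
    then obtain m where m: "m \<in> S" "x = v m" by blast
    have "(\<Sum>n\<in>S. scale (f (v n)) (v n)) = 0" using sum by (simp add: sum.reindex[OF inj])
    then have "scale (f (v m)) (v m) = 0"
      using eigenvectors_sum_zero[OF T S, of "\<lambda>n. scale (f (v n)) (v n)" m] m v(1)
      by (simp add: T.scale mult.commute)
    then show "f x = 0" using v(2)[OF m(1)] m by simp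
  qed (simp add: S)
qed

section \<open>Dimension counts\<close>

text \<open>\<open>dim\<close> is the cardinality of a basis, and an infinite set has cardinality 0;
  a positive value therefore forces a finite basis.\<close>

lemma finite_basis_of_dim:
  assumes "dim UNIV = Suc d"
  obtains C where "finite C" "card C = Suc d" "span C = UNIV"
proof -
  obtain C where C: "C \<subseteq> UNIV" "independent C" "UNIV \<subseteq> span C" "card C = dim UNIV"
    using basis_exists[of UNIV] by blast
  then have "finite C" using assms card.infinite by fastforce
  then show thesis using that[of C] C assms by auto
qed

lemma independent_card_le_of_dim:
  assumes "dim UNIV = Suc d" "independent S"
  shows "finite S" "card S \<le> Suc d"
proof -
  obtain C where C: "finite C" "card C = Suc d" "span C = UNIV"
    using finite_basis_of_dim[OF assms(1)] .
  then show "finite S" "card S \<le> Suc d"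
    using independent_span_bound[OF C(1) assms(2)] by auto
qed

text \<open>Otherwise \<open>v 0\<close>, ..., \<open>v (Suc d)\<close> would be
  \<open>d + 2\<close> independent vectors. This is what terminates strings of raising and lowering
  operators.\<close>

lemma eigenvector_vanishes:
  assumes dim: "dim UNIV = Suc d"
    and T: "Vector_Spaces.linear scale scale T" and \<mu>: "inj \<mu>"
    and v: "\<And>n :: nat. T (v n) = scale (\<mu> n) (v n)"
  shows "\<exists>n. v n = 0"
proof (rule ccontr)
  assume nz: "\<nexists>n. v n = 0"
  have "inj_on \<mu> {..Suc d}" using \<mu> by (rule inj_on_subset) simp
  then have "inj_on v {..Suc d}" "independent (v ` {..Suc d})"
    using eigenvectors_independent[OF T _ _ v, of "{..Suc d}"] nz by auto
  then have "card (v ` {..Suc d}) = Suc (Suc d)" "card (v ` {..Suc d}) \<le> Suc d"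
    using independent_card_le_of_dim(2)[OF dim] by (simp add: card_image, blast)
  then show False by simp
qed

text \<open>A vector outside the span would extend the family to \<open>d + 2\<close> independent
  vectors.\<close>

lemma basis_seq_of_independent:
  assumes dim: "dim UNIV = Suc d" and u: "inj_on u {..d}" "independent (u ` {..d})"
  shows "basis_seq scale d u"
proof -
  have c: "card (u ` {..d}) = Suc d" using u(1) by (simp add: card_image)
  have "x \<in> span (u ` {..d})" for x
  proof (rule ccontr)
    assume x: "x \<notin> span (u ` {..d})"
    then have "x \<notin> u ` {..d}" using span_base[of x] by metis
    then have "card (insert x (u ` {..d})) = Suc (Suc d)" using c by simp
    moreover have "independent (insert x (u ` {..d}))"
      using x u(2) by (rule independent_insertI)
    ultimately show False
      using independent_card_le_of_dim(2)[OF dim, of "insert x (u ` {..d})"] by linarith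
  qed
  then show ?thesis using u by (auto simp: basis_seq_def)
qed

lemma basis_seq_combination:
  assumes "basis_seq scale d u"
  obtains c where "x = (\<Sum>n\<le>d. scale (c n) (u n))"
proof -
  have inj: "inj_on u {..d}" and "x \<in> span (u ` {..d})" using assms by (auto simp: basis_seq_def)
  then obtain c where "x = (\<Sum>y\<in>u ` {..d}. scale (c y) y)"
    by (auto simp: span_finite)
  then have "x = (\<Sum>n\<le>d. scale (c (u n)) (u n))" by (simp add: sum.reindex[OF inj])
  then show thesis by (rule that)
qed

text \<open>For a nonzero polynomial \<open>p\<close> of least degree with \<open>p(T) v = 0\<close> and a root \<open>r\<close> of \<open>p\<close>, the
  vector \<open>(p / (X - r))(T) v\<close> is an eigenvector.\<close>

lemma eigenvector_exists:
  fixes T :: "'b \<Rightarrow> 'b"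
  assumes closed: "\<And>p :: 'a poly. degree p > 0 \<Longrightarrow> \<exists>r. poly p r = 0"
    and dim: "dim UNIV = Suc d"
    and T: "Vector_Spaces.linear scale scale T"
  shows "\<exists>c v. v \<noteq> 0 \<and> T v = scale c v"
proof -
  interpret T: module_hom scale scale T using T by (simp add: Vector_Spaces.linear_def)
  have "\<exists>v :: 'b. v \<noteq> 0"
  proof (rule ccontr)
    assume "\<not> ?thesis"
    then have "x = 0" for x :: 'b by blast
    then have "(UNIV :: 'b set) \<subseteq> span {}" by auto
    then have "span {} = (UNIV :: 'b set)" by blast
    then have "dim (UNIV :: 'b set) = 0" using dim_eq_card_independent[OF independent_empty] by (metis dim_span card.empty)
    then show False using dim by simp
  qed
  then obtain v :: 'b where v: "v \<noteq> 0" by blast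
  \<comment> \<open>\<open>ap p\<close> is p(T) v.\<close>
  define ap where "ap p = (\<Sum>n\<le>degree p. scale (coeff p n) ((T ^^ n) v))" for p
  have ap: "ap p = (\<Sum>n\<le>N. scale (coeff p n) ((T ^^ n) v))" if "degree p \<le> N" for p N
    unfolding ap_def using that
    by (intro sum.mono_neutral_left) (auto simp: coeff_eq_0)
  have ap_factor: "ap ([:- r, 1:] * q) = T (ap q) - scale r (ap q)" for r q
  proof -
    have "ap ([:- r, 1:] * q) = ap (pCons 0 q) - scale r (ap q)"
    proof -
      let ?N = "Suc (degree q)"
      have "degree ([:- r, 1:] * q) \<le> ?N" using degree_mult_le[of "[:- r, 1:]" q] by simp
      moreover have "degree (pCons 0 q) \<le> ?N" by (rule degree_pCons_le)
      moreover have "degree q \<le> ?N" by simp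
      ultimately show ?thesis
        by (simp only: ap mult_pCons_left mult_zero_left add_0_right coeff_add coeff_smult scale_sum_right
            scale_left_distrib sum.distrib scale_scale)
          (simp add: sum_negf del: sum.atMost_Suc)
    qed
    moreover have "ap (pCons 0 q) = T (ap q)"
    proof -
      have "ap (pCons 0 q) = (\<Sum>n\<le>Suc (degree q). scale (coeff (pCons 0 q) n) ((T ^^ n) v))"
        by (rule ap) (rule degree_pCons_le)
      also have "\<dots> = (\<Sum>n\<le>degree q. scale (coeff q n) ((T ^^ Suc n) v))"
        by (subst sum.atMost_Suc_shift) simp
      also have "\<dots> = T (ap q)" by (simp add: ap_def T.sum T.scale)
      finally show ?thesis .
    qed
    ultimately show ?thesis by simp
  qed
  have "\<exists>p. p \<noteq> 0 \<and> ap p = 0"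
  \<comment> \<open>Dependence is a property of sets, so repetitions among the iterates of
    \<open>v\<close> are treated separately: a repetition directly yields the annihilating
    polynomial X^m - X^n.\<close>
  proof (cases "inj_on (\<lambda>n. (T ^^ n) v) {..Suc d}")
    case True
    let ?S = "(\<lambda>n. (T ^^ n) v) ` {..Suc d}"
    have "card ?S = Suc (Suc d)" using True by (simp add: card_image)
    then have "dependent ?S" using independent_card_le_of_dim(2)[OF dim, of ?S] by auto
    then obtain c y where c: "(\<Sum>x\<in>?S. scale (c x) x) = 0" "y \<in> ?S" "c y \<noteq> 0"
      by (auto simp: dependent_finite)
    then obtain m where m: "m \<le> Suc d" "y = (T ^^ m) v" by auto
    define p where "p = (\<Sum>n\<le>Suc d. monom (c ((T ^^ n) v)) n)"
    have cp: "coeff p n = (if n \<le> Suc d then c ((T ^^ n) v) else 0)" for n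
      by (auto simp: p_def coeff_sum)
    then have "degree p \<le> Suc d" by (intro degree_le) auto
    then have "ap p = (\<Sum>x\<in>?S. scale (c x) x)"
      by (simp add: ap cp sum.reindex[OF True] del: sum.atMost_Suc)
    moreover have "p \<noteq> 0"
    proof -
      have "coeff p m \<noteq> 0" using cp m c by simp
      then show ?thesis by (metis coeff_0)
    qed
    ultimately show ?thesis using c(1) by metis
  next
    case False
    then obtain m n where mn: "m \<noteq> n" "(T ^^ m) v = (T ^^ n) v" by (auto simp: inj_on_def)
    let ?p = "monom 1 m - monom 1 n :: 'a poly"
    have "coeff ?p m = 1" using mn by simp
    then have "?p \<noteq> 0" by (metis coeff_0 zero_neq_one)
    moreover have "ap ?p = 0"
    proof -
      have "degree ?p \<le> max m n" by (intro degree_diff_le) (auto simp: degree_monom_eq)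
      then show ?thesis using mn
        by (simp add: ap scale_left_diff_distrib sum_subtractf if_distrib[where f = "\<lambda>c. scale c _"] cong: if_cong)
    qed
    ultimately show ?thesis by blast
  qed
  then obtain p where p: "p \<noteq> 0" "ap p = 0" and min: "\<And>q. q \<noteq> 0 \<Longrightarrow> ap q = 0 \<Longrightarrow> degree p \<le> degree q"
    using exists_least_iff[of "\<lambda>n. \<exists>p. p \<noteq> 0 \<and> ap p = 0 \<and> degree p = n"]
    by (metis not_le)
  have "degree p > 0"
  proof (rule ccontr)
    assume "\<not> degree p > 0"
    then have "degree p = 0" by simp
    then obtain c where "p = [:c:]" by (meson degree_eq_zeroE)
    then show False using p v by (simp add: ap_def)
  qed
  then obtain r where "poly p r = 0" using closed by blast
  then obtain q where q: "p = [:- r, 1:] * q" by (metis dvdE poly_eq_0_iff_dvd)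
  with p have qnz: "q \<noteq> 0" by auto
  then have "degree p = Suc (degree q)" unfolding q by (subst degree_mult_eq) auto
  then have "ap q \<noteq> 0" using min[OF qnz] by auto
  moreover have "T (ap q) = scale r (ap q)" using ap_factor[of r q] p q by simp
  ultimately show ?thesis by blast
qed

end

section \<open>Weight bases of irreducible \<open>sl\<^sub>2\<close>-modules\<close>

context lie_module
begin

lemma act_add_right: "act x (u + v) = act x u + act x v"
  and act_scale_right: "act x (scaleV c v) = scaleV c (act x v)"
  using act_linear_right[of x] unfolding Vector_Spaces.linear_iff by blast+

lemma act_add_left: "act (x + y) v = act x v + act y v"
  and act_scale_left: "act (scale c x) v = scaleV c (act x v)"
  using act_linear_left[of v] unfolding Vector_Spaces.linear_iff by blast+

lemma act_zero_right: "act x 0 = 0"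
  using act_scale_right[of x 0 0] by simp

lemma act_sum_right: "act x (\<Sum>n\<in>S. v n) = (\<Sum>n\<in>S. act x (v n))"
  by (induction S rule: infinite_finite_induct) (simp_all add: act_zero_right act_add_right)

end

lemma sl2_mk_decomp:
  "sl2_mk p q r = sl2_scale p sl2_h + sl2_scale q sl2_e + sl2_scale r (sl2_f :: 'f::field sl2)"
  by (simp add: sl2_as_mk sl2_mk_simps)

text \<open>These are the relations of the monomials \<open>S^(d-m) T^m\<close> under
  \<open>e = S d/dT\<close> and \<open>f = T d/dS\<close>. At \<open>m = 0\<close> and
  \<open>m = d\<close> the coefficient 0 cancels the out-of-range neighbour.\<close>

locale sl2_weight_basis = lie_module sl2_scale sl2_br sc \<rho>
  for sc :: "'f::field_char_0 \<Rightarrow> 'v::ab_group_add \<Rightarrow> 'v" and \<rho> +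
  fixes d :: nat and w :: "nat \<Rightarrow> 'v"
  assumes dim_UNIV: "V.dim UNIV = Suc d"
    and w_basis: "basis_seq sc d w"
    and h_w: "m \<le> d \<Longrightarrow> \<rho> sl2_h (w m) = sc (of_nat d - 2 * of_nat m) (w m)"
    and e_w: "m \<le> d \<Longrightarrow> \<rho> sl2_e (w m) = sc (of_nat m) (w (m - 1))"
    and f_w: "m \<le> d \<Longrightarrow> \<rho> sl2_f (w m) = sc (of_nat d - of_nat m) (w (Suc m))"

text \<open>Highest weight argument: an eigenvector of \<open>h\<close> is raised by
  \<open>e\<close> until the next step gives 0, then lowered by \<open>f\<close>. The resulting
  string spans a submodule, hence everything, and the dimension determines the highest
  weight.\<close>

lemma sl2_weight_basis_exists:
  fixes sc :: "'f::{alg_closed_field, field_char_0} \<Rightarrow> 'v::ab_group_add \<Rightarrow> 'v"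
  assumes irr: "irreducible_lie_module sl2_scale sl2_br sc \<rho>" and dim: "vector_space.dim sc UNIV = Suc d"
  shows "\<exists>w. sl2_weight_basis sc \<rho> d w"
proof -
  interpret irreducible_lie_module sl2_scale sl2_br sc \<rho> by (rule irr)
  let ?e = "\<rho> sl2_e" and ?f = "\<rho> sl2_f" and ?h = "\<rho> sl2_h"
  have he: "?h (?e v) = ?e (?h v) + sc 2 (?e v)" for v
    using act_br[of sl2_h sl2_e v] by (simp add: sl2_brackets act_scale_left algebra_simps)
  have hf: "?h (?f v) = ?f (?h v) + sc (-2) (?f v)" for v
    using act_br[of sl2_h sl2_f v] unfolding sl2_brackets act_scale_left by (simp add: algebra_simps)
  have ef: "?e (?f v) = ?f (?e v) + ?h v" for v
    using act_br[of sl2_e sl2_f v] by (simp add: sl2_brackets algebra_simps)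
  obtain c0 u where u: "u \<noteq> 0" "?h u = sc c0 u"
    using V.eigenvector_exists[OF alg_closed_imp_poly_has_root dim act_linear_right[of sl2_h]] by blast
  have h_e: "?h ((?e ^^ n) u) = sc (c0 + 2 * of_nat n) ((?e ^^ n) u)" for n
  proof (induction n)
    case (Suc n)
    have "?h ((?e ^^ Suc n) u) = ?e (?h ((?e ^^ n) u)) + sc 2 ((?e ^^ Suc n) u)"
      by (simp add: he)
    then show ?case
      unfolding Suc by (simp add: act_scale_right algebra_simps flip: V.scale_left_distrib)
  qed (simp add: u)
  have "\<exists>n. (?e ^^ n) u = 0"
    by (rule V.eigenvector_vanishes[OF dim act_linear_right _ h_e]) (simp add: inj_def)
  then obtain n where n: "(?e ^^ n) u = 0" "\<And>m. m < n \<Longrightarrow> (?e ^^ m) u \<noteq> 0"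
    using exists_least_iff[of "\<lambda>n. (?e ^^ n) u = 0"] by blast
  obtain k where k: "n = Suc k" using n(1) u by (cases n) auto
  define v where "v = (?e ^^ k) u"
  define c where "c = c0 + 2 * of_nat k"
  have v: "v \<noteq> 0" "?e v = 0" "?h v = sc c v"
    using n k h_e[of k] by (simp_all add: v_def c_def)
  define g where "g m = (?f ^^ m) v" for m
  have f_g: "?f (g m) = g (Suc m)" for m by (simp add: g_def)
  have h_g: "?h (g m) = sc (c - 2 * of_nat m) (g m)" for m
  proof (induction m)
    case (Suc m)
    have "?h (g (Suc m)) = ?f (?h (g m)) + sc (-2) (g (Suc m))" by (simp add: hf flip: f_g)
    then show ?case
      unfolding Suc act_scale_right f_g by (simp add: algebra_simps flip: V.scale_left_distrib)
  qed (simp add: v g_def)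
  have e_g: "?e (g m) = sc (of_nat m * (c - of_nat m + 1)) (g (m - 1))" for m
  proof (induction m)
    case (Suc m)
    have "?e (g (Suc m)) = ?f (?e (g m)) + ?h (g m)" by (simp add: ef flip: f_g)
    also have "?f (?e (g m)) = sc (of_nat m * (c - of_nat m + 1)) (g m)"
      unfolding Suc act_scale_right f_g by (cases m) simp_all
    finally have "?e (g (Suc m)) = sc (of_nat m * (c - of_nat m + 1) + (c - 2 * of_nat m)) (g m)"
      by (simp only: h_g V.scale_left_distrib)
    moreover have "of_nat m * (c - of_nat m + 1) + (c - 2 * of_nat m) = of_nat (Suc m) * (c - of_nat (Suc m) + 1)"
      by (simp add: algebra_simps)
    ultimately show ?case by simp
  qed (simp add: v g_def)
  have "\<exists>m. g m = 0"
    by (rule V.eigenvector_vanishes[OF dim act_linear_right _ h_g]) (simp add: inj_def)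
  then obtain N where N: "g N = 0" "\<And>m. m < N \<Longrightarrow> g m \<noteq> 0"
    using exists_least_iff[of "\<lambda>n. g n = 0"] by blast
  have ind: "inj_on g {..<N}" "V.independent (g ` {..<N})"
    by (rule V.eigenvectors_independent[OF act_linear_right[of sl2_h] _ _ h_g];
        use N(2) in \<open>simp add: inj_on_def\<close>)+
  let ?W = "V.span (g ` {..<N})"
  \<comment> \<open>The range includes \<open>N\<close>, where \<open>g N = 0\<close>, so that
    \<open>f\<close> maps the last vector of the string into the span.\<close>
  have gW: "g m \<in> ?W" if "m \<le> N" for m
    using that N(1) V.span_base[of "g m"] V.span_zero by (cases "m = N") auto
  have "\<rho> X y \<in> ?W" if "y \<in> ?W" for X y
    using that
  proof (induction rule: V.span_induct_alt)
    case base
    then show ?case by (simp add: act_zero_right V.span_zero)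
  next
    case (step b x y)
    then obtain m where m: "m < N" "x = g m" by blast
    obtain p q r where "X = sl2_mk p q r" using sl2_mk_exhaust by blast
    then have "\<rho> X x = sc p (?h x) + sc q (?e x) + sc r (?f x)"
      by (simp add: sl2_mk_decomp act_add_left act_scale_left)
    also have "\<dots> \<in> ?W"
      unfolding m(2) h_g e_g f_g using m(1) by (intro V.span_add V.span_scale gW) auto
    finally show ?case using step by (simp add: act_add_right act_scale_right V.span_add V.span_scale)
  qed
  then have "?W = {0} \<or> ?W = UNIV" by (intro irreducible) auto
  moreover have "g 0 \<in> ?W" by (rule gW) simp
  moreover have "g 0 \<noteq> 0" using v by (simp add: g_def)
  ultimately have W: "?W = UNIV" by blast
  then have "V.dim UNIV = card (g ` {..<N})" using V.dim_eq_card_independent[OF ind(2)] V.dim_span by metis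
  then have N_eq: "N = Suc d" using dim ind(1) by (simp add: card_image)
  \<comment> \<open>Since \<open>g (Suc d) = 0\<close> but \<open>g d\<close> is nonzero, the
    coefficient in \<open>e_g\<close> must vanish at \<open>Suc d\<close>; in characteristic 0 this
    gives \<open>c = d\<close>.\<close>
  have "sc (of_nat (Suc d) * (c - of_nat (Suc d) + 1)) (g d) = 0"
    using e_g[of "Suc d"] N(1) unfolding N_eq by (simp only: act_zero_right diff_Suc_1)
  then have "of_nat (Suc d) * (c - of_nat (Suc d) + 1) = 0"
    using N(2)[of d] N_eq by (simp only: V.scale_eq_0_iff) auto
  then have c: "c = of_nat d" by (simp only: mult_eq_0_iff of_nat_eq_0_iff) auto
  \<comment> \<open>In the model, \<open>f^m\<close> sends \<open>S^d\<close> to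
    \<open>d!/(d-m)!\<close> times \<open>S^(d-m) T^m\<close>; \<open>s\<close> undoes this
    factor.\<close>
  define s :: "nat \<Rightarrow> 'f" where "s m = fact (d - m) / fact d" for m
  have s_nz: "s m \<noteq> 0" for m by (simp add: s_def)
  have s_Suc: "s m = (of_nat d - of_nat m) * s (Suc m)" if "m < d" for m
  proof -
    have "d - m = Suc (d - Suc m)" using that by simp
    then have "fact (d - m) = (of_nat (d - m) :: 'f) * fact (d - Suc m)" by (simp add: fact_reduce)
    then show ?thesis using that by (simp add: s_def of_nat_diff)
  qed
  let ?w = "\<lambda>m. sc (s m) (g m)"
  have "sl2_weight_basis sc \<rho> d ?w"
  proof (unfold_locales)
    show "V.dim UNIV = Suc d" by (rule dim)
    have "inj_on ?w {..d}" "V.independent (?w ` {..d})"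
      by (rule V.eigenvectors_independent[OF act_linear_right[of sl2_h], where \<mu> = "\<lambda>m. c - 2 * of_nat m"];
          use N N_eq s_nz in \<open>auto simp: act_scale_right h_g inj_on_def V.scale_left_commute\<close>)+
    then show "basis_seq sc d ?w" by (rule V.basis_seq_of_independent[OF dim])
    fix m assume m: "m \<le> d"
    show "?h (?w m) = sc (of_nat d - 2 * of_nat m) (?w m)"
      by (simp add: act_scale_right h_g c mult.commute)
    show "?f (?w m) = sc (of_nat d - of_nat m) (?w (Suc m))"
    proof (cases "m = d")
      case True
      then show ?thesis using N N_eq by (simp add: act_scale_right f_g)
    next
      case False
      then show ?thesis using m s_Suc[of m] by (simp add: act_scale_right f_g)
    qed
    show "?e (?w m) = sc (of_nat m) (?w (m - 1))"
    proof (cases m)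
      case (Suc k)
      then have "s m * (of_nat m * (c - of_nat m + 1)) = of_nat m * ((of_nat d - of_nat k) * s (Suc k))"
        by (simp add: c)
      also have "\<dots> = of_nat m * s k" using s_Suc[of k] Suc m by simp
      finally have "s m * (of_nat m * (c - of_nat m + 1)) = of_nat m * s k" .
      then show ?thesis using Suc by (simp add: act_scale_right e_g del: of_nat_Suc)
    qed (simp add: act_scale_right e_g)
  qed
  then show ?thesis by blast
qed

section \<open>The polynomial model\<close>

text \<open>Polynomials \<open>P\<close> in \<open>X\<close> of degree at most \<open>d\<close> encode the homogeneous polynomials
  \<open>S\<^sup>d P(T/S)\<close>, on which \<open>sl\<^sub>2\<close> acts by derivations with \<open>e = S d/dT\<close>, \<open>f = T d/dS\<close>.\<close>

definition sl2_diff :: "'f::field \<Rightarrow> 'f \<Rightarrow> 'f \<Rightarrow> 'f \<Rightarrow> 'f poly \<Rightarrow> 'f poly" where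
  "sl2_diff \<delta> p q r P = smult p (smult \<delta> P - [:0, 2:] * pderiv P) + smult q (pderiv P) +
     smult r ([:0, \<delta>:] * P - [:0, 0, 1:] * pderiv P)"

lemma sl2_diff_sum: "sl2_diff \<delta> p q r (\<Sum>n\<in>S. P n) = (\<Sum>n\<in>S. sl2_diff \<delta> p q r (P n))"
proof (induction S rule: infinite_finite_induct)
  case (insert x S)
  have "sl2_diff \<delta> p q r (P + Q) = sl2_diff \<delta> p q r P + sl2_diff \<delta> p q r Q" for P Q
    by (simp add: sl2_diff_def pderiv_add algebra_simps smult_add_right smult_diff_right)
  then show ?case using insert by simp
qed (simp_all add: sl2_diff_def)

text \<open>Leibniz rule: the degrees of homogeneous polynomials add up under multiplication, and
  the action is by derivations.\<close>

lemma sl2_diff_mult: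
  "sl2_diff (\<delta> + \<epsilon>) p q r (P * Q) = sl2_diff \<delta> p q r P * Q + P * sl2_diff \<epsilon> p q r Q"
proof -
  define X :: "'a poly" where "X = [:0, 1:]"
  have expand: "sl2_diff \<zeta> p q r R = [:p:] * ([:\<zeta>:] * R - [:2:] * X * pderiv R) + [:q:] * pderiv R +
      [:r:] * (X * [:\<zeta>:] * R - X * X * pderiv R)" for \<zeta> R
    by (simp add: sl2_diff_def X_def)
  have "[:\<delta> + \<epsilon>:] = [:\<delta>:] + [:\<epsilon>:]" by simp
  then show ?thesis
    unfolding expand pderiv_mult by algebra
qed

lemma sl2_diff_power:
  assumes "sl2_diff 1 p q r L = smult c L"
  shows "sl2_diff (of_nat n) p q r (L ^ n) = smult (of_nat n * c) (L ^ n)"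
proof (induction n)
  case (Suc n)
  have "sl2_diff (1 + of_nat n) p q r (L * L ^ n) = smult c L * L ^ n + L * smult (of_nat n * c) (L ^ n)"
    by (simp only: sl2_diff_mult assms Suc)
  then show ?case by (simp add: algebra_simps smult_add_left)
qed (simp add: sl2_diff_def)

lemma sl2_diff_monom:
  "sl2_diff \<delta> p q r (monom c m) = monom (p * (\<delta> - 2 * of_nat m) * c) m +
     monom (q * of_nat m * c) (m - 1) + monom (r * (\<delta> - of_nat m) * c) (Suc m)"
proof -
  have X: "[:0, x:] * monom y n = monom (x * y) (Suc n)" "[:0, 0, x:] * monom y n = monom (x * y) (Suc (Suc n))"
    for x y :: 'a and n
    by (simp_all add: smult_monom flip: monom_Suc)
  show ?thesis
    by (cases m) (simp_all only: sl2_diff_def pderiv_monom X smult_monom add_monom diff_monom diff_Suc_1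
      of_nat_0 mult_zero_left mult_zero_right monom_0 pCons_0_0 smult_0_right diff_zero add_0_right,
      simp_all add: add_monom monom_0 monom_Suc[where n = 0] algebra_simps)
qed

section \<open>Polynomials as coordinates of vectors\<close>

context sl2_weight_basis
begin

text \<open>The coordinate map \<open>X^m\<close> to \<open>w m\<close>. Coefficients beyond
  \<open>d\<close> are dropped, so injectivity and equivariance below are restricted to degree at
  most \<open>d\<close>.\<close>

definition poly_vec :: "'f poly \<Rightarrow> 'v" where
  "poly_vec P = (\<Sum>m\<le>d. sc (coeff P m) (w m))"

lemma poly_vec_add: "poly_vec (P + Q) = poly_vec P + poly_vec Q"
  by (simp add: poly_vec_def V.scale_left_distrib sum.distrib)

lemma poly_vec_smult: "poly_vec (smult c P) = sc c (poly_vec P)"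
  by (simp add: poly_vec_def V.scale_sum_right)

lemma poly_vec_sum: "poly_vec (\<Sum>n\<in>S. P n) = (\<Sum>n\<in>S. poly_vec (P n))"
  by (induction S rule: infinite_finite_induct) (simp_all add: poly_vec_add, simp_all add: poly_vec_def)

lemma poly_vec_monom: "poly_vec (monom c m) = (if m \<le> d then sc c (w m) else 0)"
  by (simp add: poly_vec_def if_distrib[where f = "\<lambda>c. sc c _"] cong: if_cong)

lemma act_poly_vec:
  assumes "degree P \<le> d"
  shows "\<rho> (sl2_mk p q r) (poly_vec P) = poly_vec (sl2_diff (of_nat d) p q r P)"
proof -
  \<comment> \<open>For \<open>m = d\<close> the monomial of degree \<open>d + 1\<close> lies
    outside the range of \<open>poly_vec\<close>, but its coefficient contains the factor
    \<open>d - m = 0\<close>, in agreement with \<open>f_w\<close>.\<close>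
  have "\<rho> (sl2_mk p q r) (poly_vec (monom c m)) = poly_vec (sl2_diff (of_nat d) p q r (monom c m))"
    if "m \<le> d" for c m
    using that le_trans[OF diff_le_self that, of 1]
    by (cases "m = d") (simp_all add: sl2_diff_monom poly_vec_add poly_vec_monom sl2_mk_decomp act_add_left
      act_scale_left act_scale_right h_w e_w f_w V.scale_right_distrib V.scale_right_diff_distrib mult_ac)
  then have "\<rho> (sl2_mk p q r) (poly_vec (\<Sum>m\<le>d. monom (coeff P m) m)) =
      poly_vec (sl2_diff (of_nat d) p q r (\<Sum>m\<le>d. monom (coeff P m) m))"
    by (simp add: poly_vec_sum sl2_diff_sum act_sum_right)
  then show ?thesis using poly_as_sum_of_monoms'[OF assms] by simp
qed

lemma poly_vec_eq_0:
  assumes "poly_vec P = 0" "degree P \<le> d"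
  shows "P = 0"
proof (rule poly_eqI)
  fix m
  show "coeff P m = coeff 0 m"
  proof (cases "m \<le> d")
    case True
    have "sc (coeff P m) (w m) = 0"
    proof (rule V.eigenvectors_sum_zero[OF act_linear_right[of sl2_h], where v = "\<lambda>m. sc (coeff P m) (w m)"])
      show "(\<Sum>m\<le>d. sc (coeff P m) (w m)) = 0" using assms(1) by (simp add: poly_vec_def)
      show "inj_on (\<lambda>m. of_nat d - 2 * of_nat m :: 'f) {..d}" by (simp add: inj_on_def)
      show "m \<in> {..d}" using True by simp
    qed (simp_all add: act_scale_right h_w mult.commute)
    moreover have "w m \<noteq> 0"
      using w_basis True V.dependent_zero[of "w ` {..d}"] by (force simp: basis_seq_def)
    ultimately show ?thesis by simp
  next
    case False
    then show ?thesis using assms(2) by (simp add: coeff_eq_0)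
  qed
qed

end

text \<open>For \<open>d = 1\<close> the linear form \<open>tet_point a i\<close> spans component 0 of the flag \<open>[i]\<close>.\<close>

fun tet_point :: "'f::field \<Rightarrow> idx \<Rightarrow> 'f poly" where
  "tet_point a I0 = [:1, a:]"
| "tet_point a I1 = [:1:]"
| "tet_point a I2 = [:1, 1:]"
| "tet_point a I3 = [:0, 1:]"

lemma degree_tet_point: "degree (tet_point a i) \<le> 1"
  by (cases i) simp_all

lemma tet_point_nz: "tet_point a i \<noteq> 0"
  by (cases i) simp_all

text \<open>The eigenline for -1 depends on \<open>i\<close> alone and that for 1 on
  \<open>j\<close> alone. This is verified for each of the twelve ordered pairs.\<close>

lemma EV_gen_tet_point:
  assumes "a \<noteq> 0" "a \<noteq> 1" "i \<noteq> j"
  obtains p q r where "EV_gen a i j = sl2_mk p q r"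
    "sl2_diff 1 p q r (tet_point a i) = smult (- 1) (tet_point a i)"
    "sl2_diff 1 p q r (tet_point a j) = smult 1 (tet_point a j)"
proof -
  \<comment> \<open>Naming the inverses turns the checks into polynomial identities modulo the
    rewrite rules \<open>bc\<close>.\<close>
  define b c where "b = inverse (1 - a)" and "c = inverse a"
  have "a * b = b - 1" "a * c = 1"
    using assms by (simp_all add: b_def c_def field_simps)
  then have bc: "a * b = b - 1" "a * (b * u) = b * u - u" "a * c = 1" "a * (c * u) = u" for u
    by (simp_all add: mult.assoc[symmetric] left_diff_distrib)
  have "\<exists>p q r. EV_gen a i j = sl2_mk p q r \<and>
    sl2_diff 1 p q r (tet_point a i) = smult (- 1) (tet_point a i) \<and>
    sl2_diff 1 p q r (tet_point a j) = smult 1 (tet_point a j)"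
    by (cases i; cases j; use assms(3) in \<open>simp_all only: EV_gen_mk[of a, folded b_def c_def] simp_thms idx.distinct\<close>)
      (rule exI, rule exI, rule exI, rule conjI[OF refl],
        simp add: sl2_diff_def pderiv_pCons algebra_simps bc)+
  then show thesis using that by blast
qed

text \<open>With \<open>P\<close>, \<open>Q\<close> the components of point \<open>i\<close> along the points \<open>k\<close>, \<open>l\<close>, the cross ratio \<open>\<alpha>\<close>
  is the relative slope of point \<open>j\<close>.\<close>

lemma tet_point_frame:
  fixes a :: "'f::field"
  assumes "a \<noteq> 0" "a \<noteq> 1" "distinct [i, j, k, l]"
  shows "\<exists>\<nu> \<nu>' \<mu>. \<nu> \<noteq> 0 \<and> \<nu>' \<noteq> 0 \<and> \<mu> \<noteq> 0 \<and>
    tet_point a i = smult \<nu> (tet_point a k) + smult \<nu>' (tet_point a l) \<and>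
    tet_point a j = smult \<mu> (smult \<nu> (tet_point a k) + smult (relative i j k l a * \<nu>') (tet_point a l))"
proof -
  \<comment> \<open>\<open>b m n\<close> is the determinant of the coefficient vectors of two
    points; it is nonzero because the four points are pairwise non-proportional.\<close>
  define b :: "idx \<Rightarrow> idx \<Rightarrow> 'f" where "b m n = coeff (tet_point a m) 0 * coeff (tet_point a n) 1 -
    coeff (tet_point a m) 1 * coeff (tet_point a n) 0" for m n
  have nz: "b m n \<noteq> 0" if "m \<noteq> n" for m n
    using that assms by (cases m; cases n) (simp_all add: b_def)
  have pt: "tet_point a m = [:coeff (tet_point a m) 0, coeff (tet_point a m) 1:]" for m
    by (cases m) simp_all
  have cramer: "smult (b k l) (tet_point a m) = smult (b m l) (tet_point a k) + smult (b k m) (tet_point a l)" for m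
    by (subst (1 2 3) pt) (simp add: b_def algebra_simps)
  \<comment> \<open>The relative is the cross ratio of the four points.\<close>
  have rel: "relative i j k l a * (b k i * b j l) = b k j * b i l"
    unfolding relative_eq[OF assms]
    using assms by (cases i; cases j; cases k; cases l) (simp_all add: b_def field_simps)
  show ?thesis
  \<comment> \<open>The witnesses come from Cramer's rule: \<open>\<nu>\<close> and
    \<open>\<nu>'\<close> are the coordinates of point \<open>i\<close>, and \<open>\<mu>\<close> is
    the quotient of the \<open>k\<close>-coordinates of points \<open>j\<close> and
    \<open>i\<close>. Then \<open>rel\<close> matches the \<open>l\<close>-coordinates.\<close>
  proof (intro exI conjI)
    have kl: "b k l \<noteq> 0" and il: "b i l \<noteq> 0" and "b j l \<noteq> 0" "b k i \<noteq> 0"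
      by (rule nz; use assms(3) in auto)+
    then show "b i l / b k l \<noteq> 0" "b k i / b k l \<noteq> 0" "b j l / b i l \<noteq> 0" by simp_all
    have *: "tet_point a m = smult (b m l / b k l) (tet_point a k) + smult (b k m / b k l) (tet_point a l)" for m
    proof -
      have "tet_point a m = smult (1 / b k l) (smult (b k l) (tet_point a m))" using kl by simp
      then show ?thesis unfolding cramer[of m] by (simp add: smult_add_right)
    qed
    show "tet_point a i = smult (b i l / b k l) (tet_point a k) + smult (b k i / b k l) (tet_point a l)"
      by (rule *)
    have "b j l / b i l * (relative i j k l a * (b k i / b k l)) = b k j / b k l"
      using rel kl il by (simp add: field_simps)
    then show "tet_point a j = smult (b j l / b i l) (smult (b i l / b k l) (tet_point a k) +
        smult (relative i j k l a * (b k i / b k l)) (tet_point a l))"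
      using il by (subst *[of j]) (simp add: smult_add_right)
  qed
qed

section \<open>Decompositions of evaluation modules\<close>

text \<open>By invariance the right radical is a submodule; it is not everything since the form is
  nonzero.\<close>

lemma standard_form_nondegenerate:
  assumes irr: "irreducible_lie_module tet_scale tet_br sc act"
    and form: "standard_form sc act B" and "v \<noteq> 0"
  shows "\<exists>u. B u v \<noteq> 0"
proof (rule ccontr)
  interpret irreducible_lie_module tet_scale tet_br sc act by (rule irr)
  assume 0: "\<nexists>u. B u v \<noteq> 0"
  have lin: "B u (x + y) = B u x + B u y" "B u (sc c x) = c * B u x" for u x y c
    using form by (auto simp: standard_form_def Vector_Spaces.linear_iff)
  have inv: "B u (act \<xi> x) = - B (act \<xi> u) x" for \<xi> u x
    using form by (simp add: standard_form_def)
  let ?R = "{x. \<forall>u. B u x = 0}"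
  have "B u 0 = 0" for u using lin(2)[of u 0 0] by simp
  then have "V.subspace ?R" by (simp add: V.subspace_def lin)
  then have "?R = {0} \<or> ?R = UNIV" by (rule irreducible) (simp add: inv)
  then have "?R = UNIV" using 0 assms(3) by auto
  then show False using form by (auto simp: standard_form_def)
qed

text \<open>The images \<open>x\<close>, \<open>y\<close>, \<open>z\<close> already span:
  \<open>x\<close> supplies the upper right entry, \<open>y\<close> the lower left one, and
  \<open>z\<close> corrects the diagonal.\<close>

lemma EV_surj:
  fixes a :: "'f::field_char_0"
  assumes "a \<noteq> 0" "a \<noteq> 1"
  shows "\<exists>\<xi>. EV a \<xi> = X"
proof -
  obtain p q r where X: "X = sl2_mk p q r" using sl2_mk_exhaust by blast
  have hom: "lie_hom tet_scale tet_br sl2_scale sl2_br (EV a)" and gen: "EV a (tet_x i j) = EV_gen a i j" for i j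
    using is_EV_EV[OF assms] by (auto simp: is_EV_iff)
  then have lin: "EV a (\<xi> + \<zeta>) = EV a \<xi> + EV a \<zeta>" "EV a (tet_scale c \<xi>) = sl2_scale c (EV a \<xi>)" for \<xi> \<zeta> c
    by (simp_all add: lie_hom_def Vector_Spaces.linear_iff)
  have "EV a (tet_scale (q / 2) (tet_x I1 I2) + tet_scale (- r / 2) (tet_x I2 I3) +
      tet_scale (p + q / 2 - r / 2) (tet_x I3 I1)) = X"
    unfolding lin gen EV_gen_mk X sl2_mk_simps by (simp add: field_simps)
  then show ?thesis by blast
qed

text \<open>Surjectivity of \<open>EV a\<close> makes every invariant subspace an
  \<open>sl2\<close>-submodule.\<close>

lemma irreducible_eval_act:
  fixes a :: "'f::field_char_0" and sc :: "'f \<Rightarrow> 'v::ab_group_add \<Rightarrow> 'v"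
  assumes a: "a \<noteq> 0" "a \<noteq> 1" and irr: "irreducible_lie_module sl2_scale sl2_br sc \<rho>"
  shows "irreducible_lie_module tet_scale tet_br sc (eval_act a \<rho>)"
proof -
  interpret M: irreducible_lie_module sl2_scale sl2_br sc \<rho> by (rule irr)
  show ?thesis
  proof (intro irreducible_lie_module.intro irreducible_lie_module_axioms.intro)
    show "lie_module tet_scale tet_br sc (eval_act a \<rho>)"
      by (rule lie_module_eval_act[OF a M.lie_module_axioms])
    show "UNIV \<noteq> {0 :: 'v}" by (rule M.nonzero)
    fix W assume W: "module.subspace sc W" "\<And>x w. w \<in> W \<Longrightarrow> eval_act a \<rho> x w \<in> W"
    then show "W = {0} \<or> W = UNIV"
      using EV_surj[OF a] by (intro M.irreducible) (metis eval_act_def)+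
  qed
qed

section \<open>Explicit decompositions and bases\<close>

locale tet_weight_module = sl2_weight_basis sc \<rho> d w
  for sc :: "'f::field_char_0 \<Rightarrow> 'v::ab_group_add \<Rightarrow> 'v" and \<rho> d w +
  fixes a :: 'f
  assumes a: "a \<noteq> 0" "a \<noteq> 1"
begin

abbreviation tact :: "'f tet \<Rightarrow> 'v \<Rightarrow> 'v" where "tact \<equiv> eval_act a \<rho>"

lemma tact_linear: "Vector_Spaces.linear sc sc (\<lambda>v. tact \<xi> v)"
  unfolding eval_act_def by (rule act_linear_right)

lemma tact_tet_x: "tact (tet_x i j) v = \<rho> (EV_gen a i j) v"
  using is_EV_EV[OF a] by (simp add: is_EV_iff eval_act_def)

lemma decomp_comp_eq: "v \<in> decomp_comp sc tact d k l n \<longleftrightarrow> tact (tet_x k l) v = sc (2 * of_nat n - of_nat d) v"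
  by (simp add: decomp_comp_def)

lemma decomp_comp_scale: "v \<in> decomp_comp sc tact d k l n \<Longrightarrow> sc c v \<in> decomp_comp sc tact d k l n"
  by (simp add: decomp_comp_eq eval_act_def act_scale_right mult.commute)

lemma decomp_comp_diff:
  assumes "u \<in> decomp_comp sc tact d k l n" "v \<in> decomp_comp sc tact d k l n"
  shows "u - v \<in> decomp_comp sc tact d k l n"
proof -
  have "tact (tet_x k l) (u + sc (-1) v) = sc (2 * of_nat n - of_nat d) (u + sc (-1) v)"
    using assms by (simp only: decomp_comp_eq eval_act_def act_add_right act_scale_right
        V.scale_right_distrib V.scale_left_commute)
  then show ?thesis by (simp add: decomp_comp_eq)
qed

lemma eigenvalues_inj: "inj_on (\<lambda>n. 2 * of_nat n - of_nat d :: 'f) S"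
  by (simp add: inj_on_def)

lemma decomp_comp_sum_zero:
  assumes "\<And>n. n \<le> d \<Longrightarrow> v n \<in> decomp_comp sc tact d k l n" "(\<Sum>n\<le>d. v n) = 0" "n \<le> d"
  shows "v n = 0"
  by (rule V.eigenvectors_sum_zero[OF tact_linear _ eigenvalues_inj, of "{..d}"])
    (use assms in \<open>auto simp: decomp_comp_eq\<close>)

lemma decomp_comp_basis_seq:
  assumes "\<And>n. n \<le> d \<Longrightarrow> v n \<in> decomp_comp sc tact d k l n" "\<And>n. n \<le> d \<Longrightarrow> v n \<noteq> 0"
  shows "basis_seq sc d v"
  by (rule V.basis_seq_of_independent[OF dim_UNIV];
      rule V.eigenvectors_independent[OF tact_linear[of "tet_x k l"] _ eigenvalues_inj];
      use assms in \<open>auto simp: decomp_comp_eq\<close>)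

text \<open>Uniqueness: the differences of two candidates lie in distinct eigenspaces and sum to 0,
  so each of them vanishes.\<close>

lemma tet_basis_eqI:
  assumes u: "\<And>n. n \<le> d \<Longrightarrow> u n \<in> decomp_comp sc tact d k l n" "\<And>n. n \<le> d \<Longrightarrow> u n \<noteq> 0"
    "\<eta> i = (\<Sum>n\<le>d. u n)" "\<And>n. n > d \<Longrightarrow> u n = 0"
  shows "tet_basis sc tact d \<eta> i j k l = u"
  unfolding tet_basis_def
proof (rule the_equality)
  show "basis_seq sc d u \<and> (\<forall>n\<le>d. u n \<in> decomp_comp sc tact d k l n) \<and>
      \<eta> i = (\<Sum>n\<le>d. u n) \<and> (\<forall>n>d. u n = 0)"
    using u decomp_comp_basis_seq[of u k l] by blast
next
  fix v assume v: "basis_seq sc d v \<and> (\<forall>n\<le>d. v n \<in> decomp_comp sc tact d k l n) \<and>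
      \<eta> i = (\<Sum>n\<le>d. v n) \<and> (\<forall>n>d. v n = 0)"
  show "v = u"
  proof
    fix n
    show "v n = u n"
    proof (cases "n \<le> d")
      case True
      have "v n - u n = 0"
      proof (rule decomp_comp_sum_zero[where v = "\<lambda>n. v n - u n"])
        show "(\<Sum>n\<le>d. v n - u n) = 0" using v u(3) by (simp add: sum_subtractf)
      qed (use v u(1) True in \<open>auto intro: decomp_comp_diff\<close>)
      then show ?thesis by simp
    qed (use v u(4) in auto)
  qed
qed

text \<open>By the Leibniz rule the eigenvalues add up to
  \<open>-(d - n) + n = 2n - d\<close>.\<close>

lemma tet_point_product_decomp_comp:
  assumes "k \<noteq> l" "n \<le> d"
  shows "poly_vec (tet_point a k ^ (d - n) * tet_point a l ^ n) \<in> decomp_comp sc tact d k l n"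
    and "poly_vec (tet_point a k ^ (d - n) * tet_point a l ^ n) \<noteq> 0"
proof -
  let ?P = "tet_point a k ^ (d - n)" and ?Q = "tet_point a l ^ n"
  obtain p q r where pqr: "EV_gen a k l = sl2_mk p q r"
    "sl2_diff 1 p q r (tet_point a k) = smult (- 1) (tet_point a k)"
    "sl2_diff 1 p q r (tet_point a l) = smult 1 (tet_point a l)"
    using EV_gen_tet_point[OF a assms(1)] .
  have "degree (tet_point a m ^ e) \<le> e" for m e
    using order_trans[OF degree_power_le mult_le_mono1[OF degree_tet_point]] by simp
  from this[of k "d - n"] this[of l n] have deg: "degree (?P * ?Q) \<le> d"
    using degree_mult_le[of ?P ?Q] assms(2) by linarith
  have "sl2_diff (of_nat (d - n) + of_nat n) p q r (?P * ?Q) =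
      smult (of_nat (d - n) * - 1) ?P * ?Q + ?P * smult (of_nat n * 1) ?Q"
    by (simp only: sl2_diff_mult sl2_diff_power[OF pqr(2)] sl2_diff_power[OF pqr(3)])
  also have "\<dots> = smult (2 * of_nat n - of_nat d) (?P * ?Q)"
    using assms(2) by (simp add: of_nat_diff smult_add_left[symmetric])
  finally have "sl2_diff (of_nat d) p q r (?P * ?Q) = smult (2 * of_nat n - of_nat d) (?P * ?Q)"
    using assms(2) by (simp add: of_nat_diff)
  then show "poly_vec (?P * ?Q) \<in> decomp_comp sc tact d k l n"
    by (simp add: decomp_comp_eq tact_tet_x pqr(1) act_poly_vec[OF deg] poly_vec_smult)
  show "poly_vec (?P * ?Q) \<noteq> 0"
    using poly_vec_eq_0[OF _ deg] by (auto simp: tet_point_nz)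
qed

lemma decomp_comp_span:
  assumes "k \<noteq> l" "n \<le> d" "v \<in> decomp_comp sc tact d k l n"
  shows "\<exists>c. v = sc c (poly_vec (tet_point a k ^ (d - n) * tet_point a l ^ n))"
proof -
  let ?E = "\<lambda>n. poly_vec (tet_point a k ^ (d - n) * tet_point a l ^ n)"
  note E = tet_point_product_decomp_comp[OF assms(1)]
  have "basis_seq sc d ?E" by (rule decomp_comp_basis_seq) (rule E; assumption)+
  then obtain c where c: "v = (\<Sum>m\<le>d. sc (c m) (?E m))" by (rule V.basis_seq_combination)
  have "sc (c n) (?E n) - (if n = n then v else 0) = 0"
  \<comment> \<open>Subtracting \<open>v\<close> from the \<open>n\<close>-th term of its own
    expansion leaves eigenvectors with sum 0, so that term equals \<open>v\<close>.\<close>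
  proof (rule decomp_comp_sum_zero[where v = "\<lambda>m. sc (c m) (?E m) - (if m = n then v else 0)"])
    show "(\<Sum>m\<le>d. sc (c m) (?E m) - (if m = n then v else 0)) = 0"
      using assms(2) c by (simp add: sum_subtractf)
    fix m assume "m \<le> d"
    moreover have "0 \<in> decomp_comp sc tact d k l m"
      by (simp add: decomp_comp_eq eval_act_def act_zero_right)
    ultimately show "sc (c m) (?E m) - (if m = n then v else 0) \<in> decomp_comp sc tact d k l m"
      using assms(3) E(1)[of m] by (intro decomp_comp_diff decomp_comp_scale) auto
  qed (rule assms)
  then show ?thesis by auto
qed

lemma flag_comp_0_span:
  assumes "v \<in> flag_comp sc tact d i 0"
  shows "\<exists>c. v = sc c (poly_vec (tet_point a i ^ d))"
proof -
  define j where "j = (SOME j. j \<noteq> i)"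
  have "\<exists>j. j \<noteq> i" by (cases i) blast+
  then have "j \<noteq> i" unfolding j_def by (rule someI_ex)
  moreover have "v \<in> decomp_comp sc tact d i j 0"
    using assms by (auto simp: flag_comp_def j_def Let_def)
  ultimately show ?thesis using decomp_comp_span[of i j 0 v] by auto
qed

text \<open>The terms of the binomial expansion of \<open>(P + Q)^d\<close> lie in the right
  components and are nonzero in characteristic 0. Keeping \<open>P\<close> and \<open>Q\<close> as
  parameters yields all four bases of the theorem.\<close>

lemma tet_basis_binomial:
  assumes "k \<noteq> l" and P: "P = smult \<nu> (tet_point a k)" "\<nu> \<noteq> 0" and Q: "Q = smult \<nu>' (tet_point a l)" "\<nu>' \<noteq> 0"
    and i: "tet_point a i = P + Q" and \<eta>: "\<eta> i = sc c (poly_vec (tet_point a i ^ d))" "c \<noteq> 0"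
  shows "tet_basis sc tact d \<eta> i j k l =
      (\<lambda>n. if n \<le> d then sc c (poly_vec (smult (of_nat (d choose n)) (P ^ (d - n) * Q ^ n))) else 0)"
      (is "?b = ?u")
    and "basis_seq sc d (tet_basis sc tact d \<eta> i j k l)"
    and "n \<le> d \<Longrightarrow> tet_basis sc tact d \<eta> i j k l n \<in> decomp_comp sc tact d k l n"
    and "\<eta> i = (\<Sum>n\<le>d. tet_basis sc tact d \<eta> i j k l n)"
proof -
  let ?E = "\<lambda>n. poly_vec (tet_point a k ^ (d - n) * tet_point a l ^ n)"
  note E = tet_point_product_decomp_comp[OF assms(1)]
  have u_E: "?u n = sc (c * of_nat (d choose n) * (\<nu> ^ (d - n) * \<nu>' ^ n)) (?E n)" if "n \<le> d" for n
    using that by (simp add: P Q smult_power poly_vec_smult mult_ac flip: poly_vec_smult)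
  have comp: "?u n \<in> decomp_comp sc tact d k l n" if "n \<le> d" for n
    unfolding u_E[OF that] by (intro decomp_comp_scale E that)
  have nz: "?u n \<noteq> 0" if "n \<le> d" for n
    unfolding u_E[OF that] using that P Q \<eta> E(2)[OF that] by simp
  have sum_u: "\<eta> i = (\<Sum>n\<le>d. ?u n)"
  proof -
    have "tet_point a i ^ d = (\<Sum>n\<le>d. smult (of_nat (d choose n)) (P ^ (d - n) * Q ^ n))"
      unfolding i by (subst add.commute) (simp add: binomial_ring of_nat_poly mult_ac)
    then show ?thesis by (simp add: \<eta> poly_vec_sum V.scale_sum_right)
  qed
  show eq: "?b = ?u" using sum_u comp nz by (intro tet_basis_eqI) auto
  show "basis_seq sc d ?b" unfolding eq by (rule decomp_comp_basis_seq[OF comp nz])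
  show "n \<le> d \<Longrightarrow> ?b n \<in> decomp_comp sc tact d k l n" unfolding eq by (rule comp)
  show "\<eta> i = (\<Sum>n\<le>d. ?b n)" unfolding eq by (rule sum_u)
qed

text \<open>Invariance of the form makes eigenspaces of \<open>x\<^sub>k\<^sub>l\<close> orthogonal unless their
  eigenvalues are opposite.\<close>

lemma standard_form_sum_decomp_comp:
  assumes form: "standard_form sc tact B"
    and u: "\<And>n. n \<le> d \<Longrightarrow> u n \<in> decomp_comp sc tact d k l n"
    and v: "v \<in> decomp_comp sc tact d k l d"
  shows "B (\<Sum>n\<le>d. sc (c n) (u n)) v = c 0 * B (u 0) v"
proof -
  have lin: "B (x + y) z = B x z + B y z" "B (sc c x) z = c * B x z" "B z (sc c x) = c * B z x" for z x y c
    using form by (auto simp: standard_form_def Vector_Spaces.linear_iff)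
  have "B 0 z = 0" for z using lin(2)[of 0 0 z] by simp
  then have sum: "B (\<Sum>n\<in>S. x n) z = (\<Sum>n\<in>S. B (x n) z)" for S z and x :: "nat \<Rightarrow> 'v"
    by (induction S rule: infinite_finite_induct) (simp_all add: lin)
  \<comment> \<open>The eigenvalue of \<open>v\<close> is \<open>d\<close>, and only
    \<open>n = 0\<close> has the opposite one.\<close>
  have "B (u n) v = 0" if "n \<le> d" "n \<noteq> 0" for n
  proof -
    have "B (tact (tet_x k l) (u n)) v = - B (u n) (tact (tet_x k l) v)"
      using form by (simp add: standard_form_def)
    also have "tact (tet_x k l) (u n) = sc (2 * of_nat n - of_nat d) (u n)"
      using u[OF that(1)] by (simp only: decomp_comp_eq)
    also have "tact (tet_x k l) v = sc (of_nat d) v"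
      using v by (simp add: decomp_comp_eq)
    finally have "(2 * of_nat n) * B (u n) v = 0"
      unfolding lin by (simp add: algebra_simps)
    then show ?thesis using that by simp
  qed
  then have "(\<Sum>n\<le>d. c n * B (u n) v) = (\<Sum>n\<le>d. if n = 0 then c 0 * B (u 0) v else 0)"
    by (intro sum.cong) auto
  then show ?thesis by (simp add: sum lin)
qed

end

section \<open>Binomial expansion after a shift of variables\<close>

text \<open>Expanding \<open>(P + c * Q)^(d - s)\<close> and collecting powers of \<open>Q\<close>
  reduces the claim to the identity (d choose s)(d-s choose r-s) = (d choose r)(r choose s).\<close>

lemma binomial_shift:
  fixes P Q :: "'a::comm_ring_1"
  assumes "s \<le> d"
  shows "of_nat (d choose s) * ((P + c * Q) ^ (d - s) * (b * Q) ^ s) =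
    (\<Sum>r\<le>d. (if s \<le> r then of_nat (r choose s) * c ^ (r - s) * b ^ s else 0) *
      (of_nat (d choose r) * (P ^ (d - r) * Q ^ r)))"
proof -
  have "(P + c * Q) ^ (d - s) = (\<Sum>m\<le>d - s. of_nat ((d - s) choose m) * (c * Q) ^ m * P ^ (d - s - m))"
    by (subst add.commute) (rule binomial_ring)
  then have "of_nat (d choose s) * ((P + c * Q) ^ (d - s) * (b * Q) ^ s) =
      (\<Sum>m\<le>d - s. of_nat ((d choose s) * ((d - s) choose m)) * (c ^ m * b ^ s) * (P ^ (d - s - m) * Q ^ (m + s)))"
    by (simp add: sum_distrib_left sum_distrib_right power_mult_distrib power_add mult_ac)
  also have "\<dots> = (\<Sum>r\<in>{s..d}. of_nat ((d choose s) * ((d - s) choose (r - s))) * (c ^ (r - s) * b ^ s) *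
      (P ^ (d - r) * Q ^ r))"
    by (rule sum.reindex_bij_witness[where i = "\<lambda>r. r - s" and j = "\<lambda>m. m + s"])
      (use assms in \<open>auto simp: algebra_simps\<close>)
  also have "\<dots> = (\<Sum>r\<in>{s..d}. of_nat (r choose s) * c ^ (r - s) * b ^ s * (of_nat (d choose r) * (P ^ (d - r) * Q ^ r)))"
  proof (rule sum.cong)
    fix r assume "r \<in> {s..d}"
    then have "(d choose s) * ((d - s) choose (r - s)) = (d choose r) * (r choose s)"
      by (simp add: choose_mult)
    then show "of_nat ((d choose s) * ((d - s) choose (r - s))) * (c ^ (r - s) * b ^ s) * (P ^ (d - r) * Q ^ r) =
        of_nat (r choose s) * c ^ (r - s) * b ^ s * (of_nat (d choose r) * (P ^ (d - r) * Q ^ r))"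
      by (simp only:) (simp add: mult_ac)
  qed simp
  also have "\<dots> = (\<Sum>r\<le>d. (if s \<le> r then of_nat (r choose s) * c ^ (r - s) * b ^ s else 0) *
      (of_nat (d choose r) * (P ^ (d - r) * Q ^ r)))"
    by (rule sum.mono_neutral_cong_left) auto
  finally show ?thesis .
qed

section \<open>The transition matrices\<close>

text \<open>Scalars become constant polynomials, so the identity in a commutative ring
  applies.\<close>

lemma binomial_shift_poly:
  fixes P Q :: "'f::field poly"
  assumes "s \<le> d"
  shows "smult (of_nat (d choose s)) ((P + smult c Q) ^ (d - s) * smult b Q ^ s) =
    (\<Sum>r\<le>d. smult (if s \<le> r then of_nat (r choose s) * c ^ (r - s) * b ^ s else 0)
      (smult (of_nat (d choose r)) (P ^ (d - r) * Q ^ r)))"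
proof -
  have const: "smult x R = [:x:] * R" for x and R :: "'f poly" by simp
  have "[:if s \<le> r then of_nat (r choose s) * c ^ (r - s) * b ^ s else 0:] =
      (if s \<le> r then of_nat (r choose s) * [:c:] ^ (r - s) * [:b:] ^ s else 0)" for r
    by (simp add: of_nat_poly poly_const_pow)
  then show ?thesis
    unfolding const using binomial_shift[OF assms, of P "[:c:]" Q "[:b:]"]
    by (simp only: of_nat_poly)
qed

theorem theorem13p1:
  fixes a :: "'f::{alg_closed_field, field_char_0}"
    and sc :: "'f \<Rightarrow> 'v::ab_group_add \<Rightarrow> 'v"
    and \<rho> :: "'f sl2 \<Rightarrow> 'v \<Rightarrow> 'v"
    and act :: "'f tet \<Rightarrow> 'v \<Rightarrow> 'v"
    and d :: nat
    and \<eta> :: "idx \<Rightarrow> 'v"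
    and B :: "'v \<Rightarrow> 'v \<Rightarrow> 'f"
    and \<alpha> :: 'f
    and i j k l :: idx
  assumes d: "d \<ge> 1"
    and a: "a \<noteq> 0" "a \<noteq> 1"
    and V_d: "irreducible_lie_module sl2_scale sl2_br sc \<rho>" "vector_space.dim sc UNIV = d + 1"
    and act: "act = eval_act a \<rho>"
    and \<eta>: "\<And>m. \<eta> m \<in> flag_comp sc act d m 0" "\<And>m. \<eta> m \<noteq> 0"
    and B: "standard_form sc act B"
    and ijkl: "distinct [i, j, k, l]"
    and \<alpha>: "\<alpha> = relative i j k l a"
  shows "is_transition_matrix sc d (tet_basis sc act d \<eta> i j k l) (tet_basis sc act d \<eta> j i k l)
           (\<lambda>r s. if r = s then B (\<eta> j) (\<eta> l) / B (\<eta> i) (\<eta> l) * \<alpha> ^ r else 0)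
    \<and> is_transition_matrix sc d (tet_basis sc act d \<eta> i j k l) (tet_basis sc act d \<eta> i k j l)
           (\<lambda>r s. if s \<le> r then of_nat (r choose s) * \<alpha> ^ (r - s) * (1 - \<alpha>) ^ s else 0)
    \<and> is_transition_matrix sc d (tet_basis sc act d \<eta> i j k l) (tet_basis sc act d \<eta> i j l k)
           (\<lambda>r s. if r + s = d then 1 else 0)"
proof -
  obtain w where w: "sl2_weight_basis sc \<rho> d w"
    using sl2_weight_basis_exists[OF V_d(1)] V_d(2) by auto
  interpret sl2_weight_basis sc \<rho> d w by (rule w)
  interpret tet_weight_module sc \<rho> d w a by unfold_locales (rule a)+
  note \<eta>_flag = \<eta>(1)[unfolded act]
  obtain \<nu> \<nu>' \<mu> where nz: "\<nu> \<noteq> 0" "\<nu>' \<noteq> 0" "\<mu> \<noteq> 0"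
    and i: "tet_point a i = smult \<nu> (tet_point a k) + smult \<nu>' (tet_point a l)"
    and j: "tet_point a j = smult \<mu> (smult \<nu> (tet_point a k) + smult (\<alpha> * \<nu>') (tet_point a l))"
    using tet_point_frame[OF a ijkl] unfolding \<alpha> by blast
  have \<alpha>_nz: "\<alpha> \<noteq> 0" "\<alpha> \<noteq> 1"
    using cr_val_nz[OF a ijkl] by (simp_all add: \<alpha> relative_eq[OF a ijkl] cr_val_def)
  obtain c where c: "\<eta> m = sc (c m) (poly_vec (tet_point a m ^ d))" for m
    using flag_comp_0_span[OF \<eta>_flag] by metis
  have c_nz: "c m \<noteq> 0" for m using c[of m] \<eta>(2)[of m] by auto
  define P where "P = smult \<nu> (tet_point a k)"
  define Q where "Q = smult \<nu>' (tet_point a l)"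
  define E where "E n = poly_vec (smult (of_nat (d choose n)) (P ^ (d - n) * Q ^ n))" for n
  let ?u = "tet_basis sc tact d \<eta> i j k l"
  have kl: "k \<noteq> l" "l \<noteq> k" "j \<noteq> l" using ijkl by auto
  have iPQ: "tet_point a i = P + Q" by (simp add: i P_def Q_def)
  have jPQ: "tet_point a j = smult \<mu> (P + smult \<alpha> Q)" by (simp add: j P_def Q_def)
  note basis_u = tet_basis_binomial[where \<eta> = \<eta> and i = i and c = "c i" and j = j, OF kl(1) P_def nz(1) Q_def nz(2) iPQ c c_nz]
  have u: "?u n = sc (c i) (E n)" if "n \<le> d" for n
    using that by (simp add: basis_u(1) E_def)

  \<comment> \<open>Exchanging \<open>i\<close> and \<open>j\<close>: the diagonal matrix\<close>
  have "is_transition_matrix sc d ?u (tet_basis sc tact d \<eta> j i k l)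
      (\<lambda>r s. if r = s then B (\<eta> j) (\<eta> l) / B (\<eta> i) (\<eta> l) * \<alpha> ^ r else 0)"
  proof -
    \<comment> \<open>\<open>?x\<close> is the factor at \<open>n = 0\<close>, to be identified with
      the ratio of form values.\<close>
    let ?v = "tet_basis sc tact d \<eta> j i k l" and ?x = "c j / c i * \<mu> ^ d"
    have "smult \<mu> P = smult (\<mu> * \<nu>) (tet_point a k)" "\<mu> * \<nu> \<noteq> 0"
      "smult (\<mu> * \<alpha>) Q = smult (\<mu> * \<alpha> * \<nu>') (tet_point a l)" "\<mu> * \<alpha> * \<nu>' \<noteq> 0"
      "tet_point a j = smult \<mu> P + smult (\<mu> * \<alpha>) Q"
      using nz \<alpha>_nz by (simp_all add: P_def Q_def j smult_add_right mult_ac)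
    note basis_v = tet_basis_binomial[where \<eta> = \<eta> and i = j and c = "c j" and j = i, OF kl(1) this c c_nz]
    have v: "?v n = sc (?x * \<alpha> ^ n) (?u n)" if "n \<le> d" for n
    proof -
      have "\<mu> ^ d = \<mu> ^ (d - n) * \<mu> ^ n" using that by (simp flip: power_add)
      then have "smult \<mu> P ^ (d - n) * smult (\<mu> * \<alpha>) Q ^ n = smult (\<mu> ^ d * \<alpha> ^ n) (P ^ (d - n) * Q ^ n)"
        by (simp add: smult_power power_mult_distrib mult_ac)
      then have "?v n = sc (c j * (\<mu> ^ d * \<alpha> ^ n)) (E n)"
        using that by (simp add: basis_v(1) E_def poly_vec_smult mult_ac)
      then show ?thesis using that c_nz[of i] by (simp add: u)
    qed
    \<comment> \<open>Lying in component \<open>d\<close>, \<open>\<eta> l\<close> pairs only with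
      component 0; pairing with it therefore reads off the coefficient of
      \<open>?u 0\<close>.\<close>
    have \<eta>_l: "\<eta> l \<in> decomp_comp sc tact d k l d"
      unfolding c[of l] using tet_point_product_decomp_comp(1)[OF kl(1) order_refl]
      by (intro decomp_comp_scale) simp
    have \<eta>_i: "\<eta> i = (\<Sum>n\<le>d. ?u n)" and \<eta>_j: "\<eta> j = (\<Sum>n\<le>d. ?v n)"
      by (rule basis_u(4) basis_v(4))+
    have pair: "B (\<Sum>n\<le>d. sc (b n) (?u n)) (\<eta> l) = b 0 * B (?u 0) (\<eta> l)" for b
      by (rule standard_form_sum_decomp_comp[OF B[unfolded act] basis_u(3) \<eta>_l])
    have B_i: "B (\<eta> i) (\<eta> l) = B (?u 0) (\<eta> l)" using pair[of "\<lambda>n. 1"] \<eta>_i by simp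
    have "(\<Sum>n\<le>d. ?v n) = (\<Sum>n\<le>d. sc (?x * \<alpha> ^ n) (?u n))" by (rule sum.cong) (simp_all add: v)
    then have B_j: "B (\<eta> j) (\<eta> l) = ?x * B (\<eta> i) (\<eta> l)"
      unfolding \<eta>_j B_i using pair[of "\<lambda>n. ?x * \<alpha> ^ n"] by simp
    \<comment> \<open>If this value were 0, \<open>pair\<close> would put \<open>\<eta> l\<close> in
      the radical of the form.\<close>
    have "B (\<eta> i) (\<eta> l) \<noteq> 0"
    proof
      assume 0: "B (\<eta> i) (\<eta> l) = 0"
      obtain y where y: "B y (\<eta> l) \<noteq> 0"
        using standard_form_nondegenerate[OF irreducible_eval_act[OF a V_d(1)] B[unfolded act] \<eta>(2)] by blast
      obtain b where "y = (\<Sum>n\<le>d. sc (b n) (?u n))" by (rule V.basis_seq_combination[OF basis_u(2)])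
      then show False using y pair[of b] 0 B_i by simp
    qed
    then have "B (\<eta> j) (\<eta> l) / B (\<eta> i) (\<eta> l) = ?x" using B_j by simp
    then show ?thesis
      using basis_u(2) basis_v(2) v
      by (simp add: is_transition_matrix_def if_distrib[where f = "\<lambda>c. sc c _"] cong: if_cong)
  qed

  \<comment> \<open>Exchanging \<open>j\<close> and \<open>k\<close>: the lower triangular
    matrix\<close>
  moreover have "is_transition_matrix sc d ?u (tet_basis sc tact d \<eta> i k j l)
      (\<lambda>r s. if s \<le> r then of_nat (r choose s) * \<alpha> ^ (r - s) * (1 - \<alpha>) ^ s else 0)"
  proof -
    let ?v = "tet_basis sc tact d \<eta> i k j l"
    \<comment> \<open>Part of \<open>Q\<close> is moved to \<open>P\<close> so that the first
      summand becomes a multiple of point \<open>j\<close>, as the decomposition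
      \<open>[j, l]\<close> requires.\<close>
    have "smult \<alpha> Q + smult (1 - \<alpha>) Q = Q" by (simp flip: smult_add_left)
    then have split: "tet_point a i = P + smult \<alpha> Q + smult (1 - \<alpha>) Q" by (simp only: iPQ add.assoc)
    have "P + smult \<alpha> Q = smult (1 / \<mu>) (tet_point a j)" "1 / \<mu> \<noteq> 0"
      "smult (1 - \<alpha>) Q = smult ((1 - \<alpha>) * \<nu>') (tet_point a l)" "(1 - \<alpha>) * \<nu>' \<noteq> 0"
      using nz \<alpha>_nz by (simp_all add: jPQ Q_def)
    note basis_v = tet_basis_binomial[where \<eta> = \<eta> and i = i and c = "c i" and j = k,
        OF kl(3) this split c c_nz]
    have "?v s = (\<Sum>r\<le>d. sc (if s \<le> r then of_nat (r choose s) * \<alpha> ^ (r - s) * (1 - \<alpha>) ^ s else 0) (?u r))"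
      if "s \<le> d" for s
    proof -
      have "?v s = sc (c i) (\<Sum>r\<le>d. sc (if s \<le> r then of_nat (r choose s) * \<alpha> ^ (r - s) * (1 - \<alpha>) ^ s else 0) (E r))"
        using that by (simp only: basis_v(1) if_True binomial_shift_poly[OF that] poly_vec_sum poly_vec_smult[of "if _ then _ else _"] E_def)
      then show ?thesis by (simp add: V.scale_sum_right u mult.commute)
    qed
    then show ?thesis using basis_u(2) basis_v(2) by (simp add: is_transition_matrix_def)
  qed

  \<comment> \<open>Exchanging \<open>k\<close> and \<open>l\<close>: the reversal matrix\<close>
  moreover have "is_transition_matrix sc d ?u (tet_basis sc tact d \<eta> i j l k) (\<lambda>r s. if r + s = d then 1 else 0)"
  proof -
    let ?v = "tet_basis sc tact d \<eta> i j l k"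
    \<comment> \<open>Exchanging the summands reverses the order of the binomial terms.\<close>
    have "tet_point a i = Q + P" by (simp add: iPQ)
    note basis_v = tet_basis_binomial[where \<eta> = \<eta> and i = i and c = "c i" and j = j, OF kl(2) Q_def nz(2) P_def nz(1) this c c_nz]
    have "?v s = (\<Sum>r\<le>d. sc (if r + s = d then 1 else 0) (?u r))" if "s \<le> d" for s
    proof -
      have "(\<Sum>r\<le>d. sc (if r + s = d then 1 else 0) (?u r)) = (\<Sum>r\<le>d. if r = d - s then ?u r else 0)"
        using that by (intro sum.cong) auto
      also have "\<dots> = ?u (d - s)" by simp
      also have "\<dots> = ?v s"
        using that by (simp add: u basis_v(1) E_def binomial_symmetric[of s d] mult.commute)
      finally show ?thesis by simp
    qed
    then show ?thesis using basis_u(2) basis_v(2) by (simp add: is_transition_matrix_def)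
  qed
  ultimately show ?thesis unfolding act by blast
qed

end
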